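(* For any integer $d \ge 2$ there exists a constant $c_d>0$ (depending only on $d$) such that for any convex body $K \subseteq \mathbb{R}^d$ whose boundary is $C^2$, there exists $\varepsilon_0>0$ depending on $K$ such that for every $0<\varepsilon\le\varepsilon_0$ there exists a polytope $P$ with $K\subseteq P$ and Hausdorff distance between $K$ and $P$ at most $\varepsilon$, whose number of facets is at most \[ \left(\frac{c_d\,\Delta_{d-1}}{\varepsilon}\right)^{\frac{d-1}{2}}, \] where $\Delta_{d-1}$ is the surface diameter of $K$.
   Context: A convex body is a compact convex set with nonempty interior. The surface diameter $\Delta_{d-1}$ of $K$ is the diameter of a Euclidean ball in $\mathbb{R}^d$ whose surface area equals the surface area of $K$. *)

theory Defs
  imports "HOL-Analysis.Analysis"
begin

definition convex_body :: "'a::euclidean_space set \<Rightarrow> bool" where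
  "convex_body K \<longleftrightarrow> compact K \<and> convex K \<and> interior K \<noteq> {}"

definition C2_boundary :: "'a::euclidean_space set \<Rightarrow> bool" where
  "C2_boundary K \<longleftrightarrow>
     (\<forall>p\<in>frontier K. \<exists>U (g::'a \<Rightarrow> real) (g' :: 'a \<Rightarrow> ('a \<Rightarrow>\<^sub>L real))
                          (g'' :: 'a \<Rightarrow> ('a \<Rightarrow>\<^sub>L ('a \<Rightarrow>\<^sub>L real))).
        open U \<and> p \<in> U \<and>
        (\<forall>x\<in>U. (g has_derivative blinfun_apply (g' x)) (at x) \<and> g' x \<noteq> 0 \<and>
                (g' has_derivative blinfun_apply (g'' x)) (at x)) \<and>
        continuous_on U g'' \<and>
        K \<inter> U = {x\<in>U. g x \<le> 0})"

text \<open>Surface area of a convex body, as the outer Minkowski content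
  (for convex bodies this equals the (d-1)-dimensional Hausdorff measure of the boundary).\<close>
definition surface_area :: "'a::euclidean_space set \<Rightarrow> real" where
  "surface_area K =
     Lim (at_right 0) (\<lambda>e. (measure lebesgue {x. infdist x K \<le> e} - measure lebesgue K) / e)"

text \<open>Surface diameter: diameter 2r of a Euclidean ball whose surface area equals that of K;
  since the surface area of a ball of radius r is r^(d-1) times that of the unit ball.\<close>
definition surface_diameter :: "'a::euclidean_space set \<Rightarrow> real" where
  "surface_diameter K =
     2 * (surface_area K / surface_area (cball (0::'a) 1)) powr (1 / (real DIM('a) - 1))"

definition hausdorff_dist :: "'a::metric_space set \<Rightarrow> 'a set \<Rightarrow> real" where
  "hausdorff_dist A B = max (SUP x\<in>A. infdist x B) (SUP y\<in>B. infdist y A)"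

end

theory Submission
  imports Defs
begin

text \<open>
  Let \<open>n\<close> be the Gauss map of \<open>K\<close> and, for a fixed large \<open>R\<close>, put
  \<open>Q(x, y) = |y - x|\<^sup>2 + R \<langle>y - x, n(y) - n(x)\<rangle>\<close>. Since \<open>n\<close> is \<open>C\<^sup>1\<close>, at small scales \<open>Q\<close> is
  comparable with the quadratic form of \<open>M = I + R A\<close>, where \<open>A\<close> is the shape operator; so \<open>Q\<close> obeys a
  quasi-triangle inequality, and the tangent planes at a maximal set of points whose cells
  \<open>{y. Q(x, y) \<le> r\<^sup>2}\<close> with \<open>r\<^sup>2 = \<epsilon> R / 18\<close> are disjoint bound a polytope within distance \<open>\<epsilon>\<close> of \<open>K\<close>.

  To count these points, look at the points outside \<open>K\<close> whose nearest point in \<open>K\<close> lies in the cell of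
  \<open>x\<close>. At height at most \<open>h\<close> they fill a box with sides of order \<open>r / sqrt m\<^sub>j\<close>, and at height between
  \<open>R\<close> and \<open>2 R\<close> a box with sides of order \<open>r * sqrt m\<^sub>j\<close>, where the \<open>m\<^sub>j\<close> are the eigenvalues of \<open>M\<close> on
  the tangent space. The product of the two volumes does not depend on the curvature. The first kind of
  box packs into a thin shell of volume about \<open>h\<close> times the surface area, the second kind into a ball of
  radius \<open>4 R\<close>, and the Cauchy-Schwarz inequality bounds the number of points.
\<close>

subsection \<open>Volume of parallel bodies\<close>

text \<open>The constant must not see the curvature, yet the cap cut off near a tangent plane has a
  size governed by the shape operator, which may even be degenerate. The summand \<open>I\<close> of
  \<open>M\<close> takes care of degenerate directions: \<open>M\<close> is at least the identity,
  so the error of the linearized Gauss map, at most \<open>\<delta>\<close> times the chord, is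
  absorbed as soon as \<open>\<delta> * R \<le> 1 / 2\<close>. Geometrically, \<open>Q(x, y)\<close>
  is the inner product of the chord \<open>y - x\<close> with the corresponding chord of the outer
  parallel surface at distance \<open>R\<close>. This is the origin of the second box: from height
  \<open>R\<close> on, projection to the closest point contracts tangentially at least about as
  strongly as the inverse of \<open>M\<close>, so the points lying over a cell spread out in just
  those directions in which the cell is narrow. Up to factors depending on \<open>d\<close>, the
  count reads \<open>N^2 * h * R * r^(2 (d - 1)) \<le> (h * S) * R^d\<close> for \<open>N\<close>
  points and surface area \<open>S\<close>. Since \<open>r^2\<close> is proportional to
  \<open>\<epsilon> * R\<close>, all powers of \<open>R\<close> and \<open>h\<close> cancel and only
  \<open>S\<close> remains. Thus \<open>R\<close> can be the radius of any ball that contains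
  \<open>K\<close>.\<close>

lemma measure_le_if_subset_nonexpansive_image:
  fixes F :: "'a::euclidean_space \<Rightarrow> 'a"
  assumes "open T" and lip: "\<And>x y. x \<in> T \<Longrightarrow> y \<in> T \<Longrightarrow> norm (F x - F y) \<le> norm (x - y)"
    and S: "S \<in> lmeasurable" "S \<subseteq> T" and W: "W \<in> lmeasurable" "W \<subseteq> F ` S"
  shows "measure lebesgue W \<le> measure lebesgue S"
proof (rule field_le_epsilon)
  fix e :: real assume "e > 0"
  obtain T' where T': "open T'" "S \<subseteq> T'" "T' - S \<in> lmeasurable" "emeasure lebesgue (T' - S) < ennreal e"
    using sets_lebesgue_outer_open[of S e] S \<open>e > 0\<close> by (metis fmeasurableD)
  have mT': "measure lebesgue (T' - S) < e"
    using T'(3,4) \<open>e > 0\<close> by (simp add: emeasure_eq_measure2 ennreal_less_iff)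
  define G where "G = T \<inter> T'"
  have G: "open G" "S \<subseteq> G" "G \<subseteq> T" using assms T' by (auto simp: G_def)
  have T'm: "T' \<in> lmeasurable"
    using fmeasurable.Un[OF T'(3) S(1)] T'(2) by (simp add: Un_absorb2)
  have Gm: "G \<in> lmeasurable"
    unfolding G_def using T'm \<open>open T\<close> by (intro fmeasurable_Int_fmeasurable[of T' _ T, simplified Int_commute]) auto
  have mG: "measure lebesgue G \<le> measure lebesgue S + e"
  proof -
    have "measure lebesgue G \<le> measure lebesgue T'"
      unfolding G_def using T'm Gm by (intro measure_mono_fmeasurable) (auto simp: G_def)
    also have "\<dots> = measure lebesgue (S \<union> (T' - S))"
      using T'(2) by (simp add: Un_absorb1)
    also have "\<dots> \<le> measure lebesgue S + measure lebesgue (T' - S)"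
      using S T'(3) by (intro measure_Un_le) auto
    finally show ?thesis using mT' by simp
  qed
  \<comment> \<open>Vitali's theorem fills \<open>G\<close> with disjoint balls up to a null set.
    \<open>F\<close> sends each ball into a closed ball of equal radius about the image of its
    centre, and the leftover null set has a null image; together these cover
    \<open>W\<close>.\<close>
  let ?I = "{(x, r). 0 < r \<and> ball x r \<subseteq> G}"
  obtain C where C: "countable C" "C \<subseteq> ?I"
      "pairwise (\<lambda>i j. disjnt (ball (fst i) (snd i)) (ball (fst j) (snd j))) C"
      "negligible (G - (\<Union>i\<in>C. ball (fst i) (snd i)))"
  proof (rule Vitali_covering_theorem_balls[of G ?I fst snd])
    fix x d assume "x \<in> G" "0 < (d::real)"
    then obtain k where k: "k > 0" "ball x k \<subseteq> G" using G(1) openE by blast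
    then show "\<exists>i. i \<in> ?I \<and> x \<in> ball (fst i) (snd i) \<and> snd i < d"
      using \<open>d > 0\<close> by (intro exI[of _ "(x, min k (d/2))"]) (auto simp: subset_iff)
  qed blast
  have Cball: "ball (fst i) (snd i) \<subseteq> G" if "i \<in> C" for i
    using subsetD[OF C(2) that] by (simp add: case_prod_unfold)
  let ?U = "\<Union>i\<in>C. cball (F (fst i)) (snd i)"
  have bound: "measure lebesgue (\<Union>i\<in>I. cball (F (fst i)) (snd i)) \<le> measure lebesgue G"
    if I: "I \<subseteq> C" "finite I" for I
  proof -
    have "measure lebesgue (\<Union>i\<in>I. cball (F (fst i)) (snd i))
        \<le> (\<Sum>i\<in>I. measure lebesgue (cball (F (fst i)) (snd i)))"
      using I by (intro measure_UNION_le) auto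
    also have "\<dots> = (\<Sum>i\<in>I. measure lebesgue (ball (fst i) (snd i)))"
    proof (rule sum.cong)
      fix i assume "i \<in> I"
      then have "snd i > 0" using I C(2) by auto
      then show "measure lebesgue (cball (F (fst i)) (snd i)) = measure lebesgue (ball (fst i) (snd i))"
        using content_ball_conv_unit_ball[of "snd i" "F (fst i)"] content_ball_conv_unit_ball[of "snd i" "fst i"]
          content_cball_conv_ball[of "F (fst i)" "snd i"]
        by simp
    qed auto
    also have "\<dots> = measure lebesgue (\<Union>i\<in>I. ball (fst i) (snd i))"
      using I C(3) by (intro measure_UNION'[symmetric]) (auto intro: pairwise_mono)
    also have "\<dots> \<le> measure lebesgue G"
      using I Gm Cball by (intro measure_mono_fmeasurable UN_least) (auto intro: sets.finite_UN)
    finally show ?thesis .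
  qed
  have Um: "?U \<in> lmeasurable" "measure lebesgue ?U \<le> measure lebesgue G"
    using fmeasurable_UN_bound[OF C(1) _ bound] measure_UN_bound[OF C(1) _ bound] by auto
  let ?N = "G - (\<Union>i\<in>C. ball (fst i) (snd i))"
  have "negligible (F ` ?N)"
  proof (rule negligible_locally_Lipschitz_image)
    fix x assume "x \<in> ?N"
    then show "\<exists>T B. open T \<and> x \<in> T \<and> (\<forall>y\<in>?N \<inter> T. norm (F y - F x) \<le> B * norm (y - x))"
      using lip G by (intro exI[of _ UNIV] exI[of _ 1]) auto
  qed (use C in auto)
  moreover have "W \<subseteq> ?U \<union> F ` ?N"
  proof
    fix w assume "w \<in> W"
    then obtain x where x: "x \<in> S" "w = F x" using W by auto
    show "w \<in> ?U \<union> F ` ?N"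
    proof (cases "x \<in> ?N")
      case False
      then obtain i where i: "i \<in> C" "x \<in> ball (fst i) (snd i)" using x G by auto
      then have "ball (fst i) (snd i) \<subseteq> T" "snd i > 0" using Cball G C(2) by fastforce+
      then have "fst i \<in> T" "x \<in> T" using i(2) by (simp_all add: subset_iff)
      then have "norm (F (fst i) - F x) \<le> norm (fst i - x)" using lip by blast
      then show ?thesis using i x by (force simp: dist_norm)
    qed (use x in auto)
  qed
  ultimately have "measure lebesgue W \<le> measure lebesgue (?U \<union> F ` ?N)"
    using Um W by (intro measure_mono_fmeasurable) (auto simp: negligible_iff_measure)
  also have "\<dots> \<le> measure lebesgue ?U + measure lebesgue (F ` ?N)"
    using Um \<open>negligible (F ` ?N)\<close> by (intro measure_Un_le) (auto simp: negligible_iff_measure)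
  also have "\<dots> \<le> measure lebesgue S + e"
    using Um mG \<open>negligible (F ` ?N)\<close> by (simp add: negligible_iff_measure)
  finally show "measure lebesgue W \<le> measure lebesgue S + e" .
qed

text \<open>The inverse of \<open>f\<close> is again an isometry, hence nonexpansive, and carries
  the image back onto \<open>S\<close>.\<close>

lemma measure_isometry_image_ge:
  fixes f :: "'a::euclidean_space \<Rightarrow> 'a"
  assumes "linear f" and iso: "\<And>x. norm (f x) = norm x" and "open S" "bounded S"
  shows "f ` S \<in> lmeasurable" "measure lebesgue S \<le> measure lebesgue (f ` S)"
proof -
  have inj: "inj f"
    using linear_injective_0[OF \<open>linear f\<close>] iso by (metis norm_eq_zero)
  have op: "open (f ` S)"
    by (metis \<open>linear f\<close> inj \<open>open S\<close> linear_injective_imp_surjective open_surjective_linear_image)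
  have bd: "bounded (f ` S)"
    using assms by (simp add: bounded_linear_image linear_conv_bounded_linear)
  show m: "f ` S \<in> lmeasurable" using op bd by (simp add: lmeasurable_open)
  have Sm: "S \<in> lmeasurable" using assms by (simp add: lmeasurable_open)
  show "measure lebesgue S \<le> measure lebesgue (f ` S)"
  proof (rule measure_le_if_subset_nonexpansive_image[of UNIV "inv f"])
    show "S \<subseteq> inv f ` f ` S" using inj by (simp add: image_inv_f_f)
    have surj: "surj f" using inj \<open>linear f\<close> by (simp add: linear_injective_imp_surjective)
    show "norm (inv f x - inv f y) \<le> norm (x - y)" for x y
      using iso[of "inv f x - inv f y"] surj \<open>linear f\<close> by (simp add: linear_diff surj_f_inv_f)
  qed (use m Sm in auto)
qed

text \<open>A one-sided Fekete argument: if \<open>m\<close> is the integer part of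
  \<open>e / t\<close>, then \<open>m\<close> copies of \<open>t\<close> fit into \<open>e\<close>
  and leave less than \<open>t\<close>, so the slope at a small \<open>t\<close> is at most
  \<open>g e / (e - t)\<close>. Since \<open>surface_area\<close> is a \<open>Lim\<close>, it
  carries information only once the limit is known to exist; that is the purpose here.\<close>

lemma superadditive_tendsto_Inf_slope:
  fixes g :: "real \<Rightarrow> real"
  assumes super: "\<And>s t. 0 < s \<Longrightarrow> 0 < t \<Longrightarrow> g s + g t \<le> g (s + t)"
    and nonneg: "\<And>t. 0 < t \<Longrightarrow> 0 \<le> g t"
  shows "((\<lambda>t. g t / t) \<longlongrightarrow> (INF t\<in>{0<..}. g t / t)) (at_right 0)"
proof -
  let ?l = "INF t\<in>{0<..}. g t / t"
  have bdd: "bdd_below ((\<lambda>t. g t / t) ` {0<..})"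
    using nonneg by (intro bdd_belowI[of _ 0]) auto
  have mono: "g s \<le> g t" if "0 < s" "s \<le> t" for s t
    using super[of s "t - s"] nonneg[of "t - s"] that by (cases "s = t") auto
  have mult: "real n * g t \<le> g (real n * t)" if "0 < t" "n > 0" for n :: nat and t
    using that(2)
  proof (induction n rule: nat_induct_non_zero)
    case (Suc n)
    then show ?case
      using super[of "real n * t" t] that by (simp add: algebra_simps)
  qed simp
  have key: "g t / t \<le> g e / (e - t)" if "0 < t" "t < e" for t e
  proof -
    define m where "m = nat \<lfloor>e / t\<rfloor>"
    have "1 \<le> e / t" using that by simp
    then have m: "m > 0" "real m \<le> e / t" "e / t < real m + 1"
      unfolding m_def by linarith+
    have mt: "real m * t \<le> e" "e - t < real m * t"
      using m that by (auto simp: field_simps)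
    have "real m * g t \<le> g (real m * t)" using mult[OF that(1) m(1)] .
    also have "\<dots> \<le> g e" using mono mt m that by simp
    finally have "g t / t \<le> g e / (real m * t)"
      using that m(1) by (simp add: field_simps)
    also have "\<dots> \<le> g e / (e - t)"
      using mt that nonneg by (intro divide_left_mono) auto
    finally show ?thesis .
  qed
  show ?thesis
  proof (rule order_tendstoI)
    fix a assume "a < ?l"
    have "a < g t / t" if "t > 0" for t
      using \<open>a < ?l\<close> cINF_lower[OF bdd, of t] that by simp
    then show "\<forall>\<^sub>F t in at_right 0. a < g t / t"
      by (intro eventually_at_right_less[of 0, THEN eventually_mono]) auto
  next
    fix a assume "?l < a"
    then obtain e where e: "e > 0" "g e / e < a"
      using cINF_less_iff[OF _ bdd] by auto
    have "((\<lambda>t. g e / (e - t)) \<longlongrightarrow> g e / (e - 0)) (at_right 0)"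
      using e by (intro tendsto_intros) auto
    then have "\<forall>\<^sub>F t in at_right 0. g e / (e - t) < a"
      using e by (intro order_tendstoD(2)) auto
    moreover have "\<forall>\<^sub>F t in at_right 0. t < e \<and> 0 < t"
      using e by (auto simp: eventually_at_right_field)
    ultimately show "\<forall>\<^sub>F t in at_right 0. g t / t < a"
      by eventually_elim (use key in fastforce)
  qed
qed

text \<open>Pushing the points of the outer shell towards \<open>K\<close> by the distance \<open>s\<close> is nonexpansive and maps onto
  the inner shell.\<close>
lemma parallel_body_superadditive:
  fixes K :: "'a::euclidean_space set"
  assumes K: "compact K" "convex K" "K \<noteq> {}" and "0 < s" "0 < h"
  defines "v \<equiv> \<lambda>e. measure lebesgue {x. infdist x K \<le> e}"
  shows "v h - measure lebesgue K \<le> v (s + h) - v s"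
proof -
  have cl: "closed K" using K compact_imp_closed by blast
  let ?p = "closest_point K" and ?d = "\<lambda>z. infdist z K"
  have d: "?d z = norm (z - ?p z)" for z
    using setdist_closest_point[OF cl K(3), of z] by (simp add: infdist_eq_setdist dist_norm)
  have p: "?p z \<in> K" for z using closest_point_in_set[OF cl K(3)] .
  have dot: "(z - ?p z) \<bullet> (x - ?p z) \<le> 0" if "x \<in> K" for x z
    using closest_point_dot[OF K(2) cl that] .
  \<comment> \<open>On \<open>K\<close> the distance is 0 and the convention 1 / 0 = 0 makes
    \<open>\<nu>\<close> vanish, so \<open>dot\<nu>\<close> holds at every point.\<close>
  define \<nu> where "\<nu> z = (1 / ?d z) *\<^sub>R (z - ?p z)" for z
  define F where "F z = z - s *\<^sub>R \<nu> z" for z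
  have K0: "{x. ?d x \<le> 0} = K"
    using infdist_nonneg[of _ K] in_closed_iff_infdist_zero[OF cl K(3)] by (auto intro: antisym)
  have comp: "{x. ?d x \<le> e} \<in> lmeasurable" if "e \<ge> 0" for e
    using compact_infdist_le[OF K(3,1), of e] K0 K(1) that
    by (cases "e = 0") (auto intro: lmeasurable_compact)
  have diff: "measure lebesgue ({x. ?d x \<le> b} - {x. ?d x \<le> a}) = v b - v a" if "0 \<le> a" "a \<le> b" for a b
    unfolding v_def using that comp[of a] comp[of b] by (intro measurable_measure_Diff) auto
  have \<nu>: "z - ?p z = ?d z *\<^sub>R \<nu> z" "norm (\<nu> z) = 1" if "?d z > 0" for z
    using that by (auto simp: \<nu>_def d)
  have dot\<nu>: "\<nu> z \<bullet> (x - ?p z) \<le> 0" if "x \<in> K" for x z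
    using dot[OF that, of z] infdist_nonneg[of z K] by (simp add: \<nu>_def divide_nonpos_nonneg)
  have "measure lebesgue ({x. ?d x \<le> h} - {x. ?d x \<le> 0}) \<le> measure lebesgue ({x. ?d x \<le> s + h} - {x. ?d x \<le> s})"
  proof (rule measure_le_if_subset_nonexpansive_image[of "{x. s < ?d x}" F])
    show "open {x. s < ?d x}"
      by (intro open_Collect_less continuous_intros)
    show "{x. ?d x \<le> s + h} - {x. ?d x \<le> s} \<in> lmeasurable" "{x. ?d x \<le> h} - {x. ?d x \<le> 0} \<in> lmeasurable"
      using comp[of h] comp[of 0] comp[of s] comp[of "s + h"] assms by (auto intro: fmeasurable.Diff)
    show "{x. ?d x \<le> h} - {x. ?d x \<le> 0} \<subseteq> F ` ({x. ?d x \<le> s + h} - {x. ?d x \<le> s})"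
    proof
      fix y assume "y \<in> {x. ?d x \<le> h} - {x. ?d x \<le> 0}"
      then have y: "0 < ?d y" "?d y \<le> h" by auto
      define z where "z = y + s *\<^sub>R \<nu> y"
      have zp: "z - ?p y = (?d y + s) *\<^sub>R \<nu> y"
        using \<nu>[OF y(1)] by (simp add: z_def algebra_simps)
      \<comment> \<open>All points of the outward ray from \<open>?p y\<close> through
        \<open>y\<close> share the closest point \<open>?p y\<close>; hence moving outwards by
        \<open>s\<close> gives a preimage of \<open>y\<close> under \<open>F\<close>.\<close>
      have "?p y = ?p z"
      proof (rule closest_point_unique[OF K(2) cl p], rule ballI)
        fix x assume "x \<in> K"
        have "(z - ?p y) \<bullet> (x - ?p y) \<le> 0"
          using dot\<nu>[OF \<open>x \<in> K\<close>, of y] y \<open>s > 0\<close> by (simp add: zp mult_nonneg_nonpos)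
        moreover have "0 \<le> (norm (x - ?p y))\<^sup>2" by simp
        ultimately have "(norm (z - ?p y))\<^sup>2 \<le> (norm (z - ?p y))\<^sup>2 - 2 * ((z - ?p y) \<bullet> (x - ?p y)) + (norm (x - ?p y))\<^sup>2"
          by linarith
        also have "\<dots> = (norm ((z - ?p y) - (x - ?p y)))\<^sup>2"
          by (simp add: power2_norm_eq_inner algebra_simps inner_commute)
        finally show "dist z (?p y) \<le> dist z x" by (simp add: dist_norm power2_le_iff_abs_le)
      qed
      then have zp': "z - ?p z = (?d y + s) *\<^sub>R \<nu> y" using zp by simp
      then have dz: "?d z = ?d y + s" using \<nu>[OF y(1)] y \<open>s > 0\<close> by (subst d) simp
      have "\<nu> z = \<nu> y" using dz zp' y \<open>s > 0\<close> unfolding \<nu>_def[of z] by simp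
      then have "F z = y" by (simp add: F_def z_def)
      then show "y \<in> F ` ({x. ?d x \<le> s + h} - {x. ?d x \<le> s})"
        using dz y by (intro image_eqI[of _ _ z]) auto
    qed
    fix x y assume xy: "x \<in> {x. s < ?d x}" "y \<in> {x. s < ?d x}"
    let ?a = "\<nu> x" and ?b = "\<nu> y"
    have Fx: "F x = ?p x + (?d x - s) *\<^sub>R ?a" and Fy: "F y = ?p y + (?d y - s) *\<^sub>R ?b"
      using \<nu>(1)[of x] \<nu>(1)[of y] xy \<open>s > 0\<close> by (auto simp: F_def algebra_simps)
    have un: "?a \<bullet> ?a = 1" "?b \<bullet> ?b = 1"
      using \<nu>(2)[of x] \<nu>(2)[of y] xy \<open>s > 0\<close> by (auto simp: norm_eq_1)
    have ab: "?a \<bullet> ?b \<le> 1"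
      using norm_cauchy_schwarz[of ?a ?b] \<nu>(2)[of x] \<nu>(2)[of y] xy \<open>s > 0\<close> by auto
    \<comment> \<open>Every term is nonnegative because the normals support \<open>K\<close> at the
      two feet. Adding \<open>s\<close> times the difference of the normals to
      \<open>F x - F y\<close> therefore cannot shorten it.\<close>
    have "(F x - F y) \<bullet> (?a - ?b) = - (?a \<bullet> (?p y - ?p x)) - ?b \<bullet> (?p x - ?p y)
        + ((?d x - s) + (?d y - s)) * (1 - ?a \<bullet> ?b)"
      unfolding Fx Fy by (simp add: inner_diff_left inner_diff_right inner_add_left inner_add_right un inner_commute algebra_simps)
    then have pos: "(F x - F y) \<bullet> (?a - ?b) \<ge> 0"
      using dot\<nu>[OF p, of x y] dot\<nu>[OF p, of y x] ab xy by simp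
    have "x - y = (F x - F y) + s *\<^sub>R (?a - ?b)" by (simp add: F_def algebra_simps)
    then have "(norm (x - y))\<^sup>2 = (norm (F x - F y))\<^sup>2 + 2 * s * ((F x - F y) \<bullet> (?a - ?b)) + s\<^sup>2 * (norm (?a - ?b))\<^sup>2"
      by (simp only: power2_norm_eq_inner inner_add_left inner_add_right inner_scaleR_left inner_scaleR_right)
        (simp add: inner_commute power2_eq_square algebra_simps)
    then have "(norm (F x - F y))\<^sup>2 \<le> (norm (x - y))\<^sup>2"
      using pos \<open>s > 0\<close> by simp
    then show "norm (F x - F y) \<le> norm (x - y)" by (simp add: power2_le_iff_abs_le)
  qed auto
  then show ?thesis
    using diff[of 0 h] diff[of s "s + h"] assms K0 by (simp add: v_def)
qed

text \<open>Superadditivity turns the limit into an infimum of slopes, so positivity can be checked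
  for each \<open>e\<close> separately: the homothety about \<open>z\<close> with ratio
  \<open>1 + e / r\<close> keeps \<open>K\<close> inside the parallel body at distance
  \<open>e\<close>, and by Bernoulli's inequality it gains at least \<open>e / r\<close> times the
  volume of \<open>K\<close>.\<close>

lemma surface_area_limit:
  fixes K :: "'a::euclidean_space set"
  assumes "convex_body K"
  shows "((\<lambda>e. (measure lebesgue {x. infdist x K \<le> e} - measure lebesgue K) / e)
      \<longlongrightarrow> surface_area K) (at_right 0)" (is ?lim)
    and "surface_area K > 0"
proof -
  have K: "compact K" "convex K" "interior K \<noteq> {}" "K \<noteq> {}"
    using assms interior_subset by (auto simp: convex_body_def)
  let ?v = "\<lambda>e. measure lebesgue {x. infdist x K \<le> e}" and ?m = "measure lebesgue K"
  let ?g = "\<lambda>e. ?v e - ?m"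
  have Km: "K \<in> lmeasurable" using K lmeasurable_compact by blast
  have vm: "{x. infdist x K \<le> e} \<in> lmeasurable" if "e > 0" for e
    using compact_infdist_le[OF K(4,1) that] lmeasurable_compact by blast
  have lim: "((\<lambda>e. ?g e / e) \<longlongrightarrow> (INF e\<in>{0<..}. ?g e / e)) (at_right 0)"
  proof (rule superadditive_tendsto_Inf_slope)
    fix s t :: real assume "0 < s" "0 < t"
    then show "?g s + ?g t \<le> ?g (s + t)"
      using parallel_body_superadditive[OF K(1,2,4)] by fastforce
  next
    fix t :: real assume "0 < t"
    then show "?g t \<ge> 0"
      using vm[OF \<open>0 < t\<close>] Km by (simp, intro measure_mono_fmeasurable) auto
  qed
  then have eq: "surface_area K = (INF e\<in>{0<..}. ?g e / e)"
    unfolding surface_area_def by (intro tendsto_Lim) auto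
  then show ?lim using lim by simp
  obtain r and z :: 'a where r: "r > 0" "K \<subseteq> cball z r"
    using compact_imp_bounded[OF K(1)] bounded_subset_ballD[of K 0] ball_subset_cball
    by (metis subset_trans)
  have mpos: "?m > 0"
    using open_not_negligible[OF open_interior K(3)] negligible_subset[of K "interior K"] interior_subset Km
    by (metis negligible_iff_measure zero_less_measure_iff measure_nonneg less_eq_real_def)
  have "?m / r \<le> ?g e / e" if "e > 0" for e
  proof -
    let ?T = "\<lambda>x. (1 + e / r) *\<^sub>R x + (- (e / r) *\<^sub>R z)"
    have "?T ` K \<subseteq> {x. infdist x K \<le> e}"
    proof clarsimp
      fix x assume "x \<in> K"
      have "dist (?T x) x = (e / r) * dist z x"
        using r that by (simp add: dist_norm algebra_simps flip: scaleR_diff_right norm_minus_commute)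
      also have "\<dots> \<le> (e / r) * r" using \<open>x \<in> K\<close> r that by (intro mult_left_mono) auto
      finally have "dist (?T x) x \<le> e" using r by simp
      then show "infdist ((1 + e / r) *\<^sub>R x - (e / r) *\<^sub>R z) K \<le> e"
        using infdist_le2[OF \<open>x \<in> K\<close>] by simp
    qed
    moreover have "compact (?T ` K)" using K by (intro compact_continuous_image continuous_intros)
    ultimately have "measure lebesgue (?T ` K) \<le> ?v e"
      using vm[OF that] by (intro measure_mono_fmeasurable) (auto dest: lmeasurable_compact)
    moreover have "measure lebesgue (?T ` K) = (1 + e / r) ^ DIM('a) * ?m"
      using measure_lebesgue_affine[of "1 + e / r" "- (e / r) *\<^sub>R z" K] that r by simp
    moreover have "(1 + e / r) ^ DIM('a) \<ge> 1 + real DIM('a) * (e / r)"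
      using that r by (intro Bernoulli_inequality) (auto intro: order.trans[of _ 0])
    moreover have "real DIM('a) * (e / r) \<ge> e / r"
      using that r mult_right_mono[of 1 "real DIM('a)" "e / r"] DIM_positive[where 'a='a] by (simp add: Suc_le_eq)
    ultimately have "(1 + e / r) * ?m \<le> ?v e"
      using mpos by (smt (verit, best) mult_right_mono)
    then show ?thesis using that r by (simp add: field_simps)
  qed
  then have "?m / r \<le> (INF e\<in>{0<..}. ?g e / e)"
    by (intro cINF_greatest) auto
  then show "surface_area K > 0"
    using eq mpos r by (metis divide_pos_pos less_le_trans)
qed

subsection \<open>Symmetric operators and strict differentiability\<close>

text \<open>Spectral theorem by induction on the dimension: a maximizer \<open>v\<close> of the
  quadratic form on the unit sphere of \<open>V\<close> is an eigenvector, and symmetry makes its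
  orthogonal complement in \<open>V\<close> invariant.\<close>

lemma symmetric_operator_eigenbasis:
  fixes A :: "'a::euclidean_space \<Rightarrow> 'a"
  assumes lin: "linear A" and sym: "\<And>x y. A x \<bullet> y = x \<bullet> A y"
    and "subspace V" and "A ` V \<subseteq> V"
  shows "\<exists>B. finite B \<and> pairwise orthogonal B \<and> (\<forall>b\<in>B. norm b = 1 \<and> (\<exists>k. A b = k *\<^sub>R b)) \<and> span B = V"
  using assms(3,4)
proof (induction "dim V" arbitrary: V rule: less_induct)
  case less
  show ?case
  proof (cases "V = {0}")
    case True
    then show ?thesis by (intro exI[of _ "{}"]) auto
  next
    case False
    then obtain v0 where v0: "v0 \<in> V" "v0 \<noteq> 0" using subspace_0[OF less.prems(1)] by auto
    let ?S = "V \<inter> sphere 0 1"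
    have "(1 / norm v0) *\<^sub>R v0 \<in> ?S"
      using v0 less.prems(1) by (auto simp: subspace_scale)
    then have ne: "?S \<noteq> {}" by blast
    have comp: "compact ?S"
      using closed_subspace[OF less.prems(1)] by (simp add: closed_Int_compact)
    have "continuous_on ?S (\<lambda>v. A v \<bullet> v)"
      using lin by (intro continuous_intros linear_continuous_on) (simp add: linear_conv_bounded_linear)
    then obtain v where v: "v \<in> ?S" and max: "\<And>w. w \<in> ?S \<Longrightarrow> A w \<bullet> w \<le> A v \<bullet> v"
      using continuous_attains_sup[OF comp ne] by blast
    define k where "k = A v \<bullet> v"
    have vV: "v \<in> V" and vn: "norm v = 1" using v by auto
    have q: "A w \<bullet> w \<le> k * (w \<bullet> w)" if "w \<in> V" for w
    proof (cases "w = 0")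
      case False
      then have "(1 / norm w) *\<^sub>R w \<in> ?S" using that less.prems(1) by (auto simp: subspace_scale)
      then have "A ((1 / norm w) *\<^sub>R w) \<bullet> ((1 / norm w) *\<^sub>R w) \<le> k"
        unfolding k_def by (rule max)
      then have "(A w \<bullet> w) / (norm w)\<^sup>2 \<le> k"
        using lin by (simp add: linear_scale power2_eq_square)
      then show ?thesis using False by (simp add: field_simps power2_norm_eq_inner)
    qed (use lin in \<open>simp add: linear_0\<close>)
    \<comment> \<open>The residual of the eigenvalue equation. Varying the maximizer in this
      direction gives the polynomial in \<open>t\<close> of fact \<open>pos\<close>, which would be
      negative for small negative \<open>t\<close> if \<open>w\<close> were nonzero.\<close>
    define w where "w = k *\<^sub>R v - A v"
    have wV: "w \<in> V" using vV less.prems by (auto simp: w_def intro!: subspace_diff subspace_scale)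
    define c where "c = k * (w \<bullet> w) - A w \<bullet> w"
    have c: "c \<ge> 0" using q[OF wV] by (simp add: c_def)
    have ww: "w \<bullet> w = k * (v \<bullet> w) - A v \<bullet> w" by (simp add: w_def inner_diff_left)
    have pos: "0 \<le> 2 * t * (w \<bullet> w) + t\<^sup>2 * c" for t
    proof -
      have "v + t *\<^sub>R w \<in> V" using vV wV less.prems by (auto intro!: subspace_add subspace_scale)
      from q[OF this] have "A v \<bullet> v + 2 * t * (A v \<bullet> w) + t\<^sup>2 * (A w \<bullet> w)
          \<le> k * (v \<bullet> v) + 2 * t * (k * (v \<bullet> w)) + t\<^sup>2 * (k * (w \<bullet> w))"
        using sym[of w v] lin
        by (simp add: linear_add linear_scale inner_add_left inner_add_right inner_commute
            power2_eq_square algebra_simps)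
      then show ?thesis using vn unfolding ww c_def
        by (simp add: k_def norm_eq_1 algebra_simps)
    qed
    have "w \<bullet> w = 0"
    proof (rule ccontr)
      assume "w \<bullet> w \<noteq> 0"
      then have p: "w \<bullet> w > 0" by simp
      \<comment> \<open>The minimizer of the polynomial has denominator \<open>c\<close>; taking
        \<open>c + 1\<close> also covers \<open>c = 0\<close>.\<close>
      let ?t = "- (w \<bullet> w) / (c + 1)"
      have "(w \<bullet> w) * (c / (c + 1)) < (w \<bullet> w) * 2"
        using c p by (intro mult_strict_left_mono) (auto simp: field_simps)
      then have "2 * (w \<bullet> w) + ?t * c > 0" by simp
      then have "?t * (2 * (w \<bullet> w) + ?t * c) < 0"
        using c p by (intro mult_neg_pos) auto
      then show False using pos[of ?t] by (simp add: power2_eq_square algebra_simps)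
    qed
    then have Av: "A v = k *\<^sub>R v" by (simp add: w_def)
    define W where "W = {x \<in> V. v \<bullet> x = 0}"
    have subW: "subspace W"
      using less.prems(1) by (auto simp: W_def subspace_def inner_add_right)
    have "v \<notin> W" using vn by (auto simp: W_def)
    moreover have "W \<subseteq> V" by (auto simp: W_def)
    ultimately have "W \<subset> V" using vV by blast
    then have "dim W < dim V"
      by (metis dim_psubset less.prems(1) span_eq_iff subW)
    moreover have "A ` W \<subseteq> W"
      using less.prems(2) Av sym by (auto simp: W_def) (metis inner_scaleR_left mult_zero_right)
    ultimately obtain B where B: "finite B" "pairwise orthogonal B"
        "\<forall>b\<in>B. norm b = 1 \<and> (\<exists>k. A b = k *\<^sub>R b)" "span B = W"
      using less.hyps[OF _ subW] by blast
    have BW: "B \<subseteq> W" using B(4) span_superset by blast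
    show ?thesis
    proof (intro exI[of _ "insert v B"] conjI ballI)
      show "pairwise orthogonal (insert v B)"
        using B(2) BW by (auto simp: pairwise_insert orthogonal_def W_def inner_commute)
      show "span (insert v B) = V"
      proof
        show "span (insert v B) \<subseteq> V"
          using vV BW less.prems(1) by (intro span_minimal) (auto simp: W_def)
        show "V \<subseteq> span (insert v B)"
        proof
          fix x assume "x \<in> V"
          then have "x - (v \<bullet> x) *\<^sub>R v \<in> W"
            using vV vn less.prems(1)
            by (auto simp: W_def inner_diff_right norm_eq_1 intro!: subspace_diff subspace_scale)
          then show "x \<in> span (insert v B)" using B(4) by (auto simp: span_insert)
        qed
      qed
    qed (use B vn Av in auto)
  qed
qed

text \<open>Indexing the eigenvectors by \<open>Basis\<close> lets the coordinates of the type serve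
  as frame coordinates, so that ordinary boxes are carried to boxes along the principal directions;
  \<open>b0\<close> marks the normal direction.\<close>

lemma symmetric_operator_eigenframe:
  fixes A :: "'a::euclidean_space \<Rightarrow> 'a"
  assumes lin: "linear A" and sym: "\<And>x y. A x \<bullet> y = x \<bullet> A y" and n: "norm n = 1" "A n = 0"
  obtains e :: "'a \<Rightarrow> 'a" and k b0 where "b0 \<in> Basis" "e b0 = n"
    "\<And>b c. b \<in> Basis \<Longrightarrow> c \<in> Basis \<Longrightarrow> e b \<bullet> e c = (if b = c then 1 else 0)"
    "\<And>b. b \<in> Basis \<Longrightarrow> A (e b) = k b *\<^sub>R e b"
proof -
  let ?V = "{x. n \<bullet> x = 0}"
  have V: "subspace ?V" "A ` ?V \<subseteq> ?V"
    using sym n(2) by (auto simp: subspace_hyperplane) (metis inner_zero_left)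
  obtain B where B: "finite B" "pairwise orthogonal B"
      "\<forall>b\<in>B. norm b = 1 \<and> (\<exists>k. A b = k *\<^sub>R b)" "span B = ?V"
    using symmetric_operator_eigenbasis[OF lin sym V] by blast
  let ?B = "insert n B"
  have BV: "B \<subseteq> ?V" using B(4) span_superset by blast
  have orth: "pairwise orthogonal ?B"
    using B(2) BV by (auto simp: pairwise_insert orthogonal_def inner_commute)
  have unit: "norm b = 1" if "b \<in> ?B" for b using that B n by auto
  have "x \<in> span ?B" for x
  proof -
    have "x - (n \<bullet> x) *\<^sub>R n \<in> span B" using n(1) by (simp add: B(4) inner_diff_right norm_eq_1)
    then show ?thesis by (auto simp: span_insert)
  qed
  then have "span ?B = UNIV" by blast
  moreover have "independent ?B"
    using orth unit by (intro pairwise_orthogonal_independent) (auto, force+)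
  ultimately have "card ?B = card (Basis :: 'a set)"
    by (metis dim_UNIV dim_span_eq_card_independent)
  then obtain e where e: "bij_betw e (Basis :: 'a set) ?B"
    using B(1) by (metis finite_Basis finite_insert finite_same_card_bij)
  obtain b0 where b0: "b0 \<in> Basis" "e b0 = n"
    using e by (metis bij_betw_iff_bijections insertI1)
  have eB: "e b \<in> ?B" if "b \<in> Basis" for b using e that by (auto simp: bij_betw_def)
  have "\<exists>k. A (e b) = k *\<^sub>R e b" if "b \<in> Basis" for b
    using eB[OF that] B(3) n(2) by (auto intro: exI[of _ 0])
  then obtain k where "\<And>b. b \<in> Basis \<Longrightarrow> A (e b) = k b *\<^sub>R e b" by metis
  moreover have "e b \<bullet> e c = (if b = c then 1 else 0)" if "b \<in> Basis" "c \<in> Basis" for b c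
  proof (cases "b = c")
    case True
    then show ?thesis using unit[OF eB[OF that(1)]] by (simp add: norm_eq_1)
  next
    case False
    then have "e b \<noteq> e c" using e that by (auto simp: bij_betw_def inj_on_def)
    then show ?thesis
      using pairwiseD[OF orth eB[OF that(1)] eB[OF that(2)]] False by (simp add: orthogonal_def)
  qed
  ultimately show ?thesis using b0 by (intro that[of b0 e k]) simp_all
qed

section \<open>Boxes in orthonormal frames\<close>

lemma inner_orthonormal_sums:
  fixes e :: "'a::euclidean_space \<Rightarrow> 'a"
  assumes e: "\<And>b c. b \<in> Basis \<Longrightarrow> c \<in> Basis \<Longrightarrow> e b \<bullet> e c = (if b = c then 1 else 0)"
    and S: "S \<subseteq> Basis"
  shows "(\<Sum>b\<in>S. f b *\<^sub>R e b) \<bullet> (\<Sum>c\<in>S. g c *\<^sub>R e c) = (\<Sum>b\<in>S. f b * g b)"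
proof -
  have fin: "finite S" using S finite_Basis finite_subset by blast
  have "(\<Sum>b\<in>S. f b *\<^sub>R e b) \<bullet> (\<Sum>c\<in>S. g c *\<^sub>R e c) = (\<Sum>b\<in>S. \<Sum>c\<in>S. f b * (g c * (e b \<bullet> e c)))"
    unfolding inner_sum_left inner_sum_right by (subst sum.swap) (simp add: mult.left_commute)
  also have "\<dots> = (\<Sum>b\<in>S. \<Sum>c\<in>S. if b = c then f b * g c else 0)"
    using S by (intro sum.cong refl) (auto simp: e subset_iff)
  also have "\<dots> = (\<Sum>b\<in>S. f b * g b)" using fin by simp
  finally show ?thesis .
qed

text \<open>Exchanging the basis for the frame is a linear isometry, so \<open>Z\<close> is a
  congruent copy of \<open>box l u\<close>.\<close>

lemma frame_box_measure:
  fixes e :: "'a::euclidean_space \<Rightarrow> 'a" and x :: 'a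
  assumes e: "\<And>b c. b \<in> Basis \<Longrightarrow> c \<in> Basis \<Longrightarrow> e b \<bullet> e c = (if b = c then 1 else 0)"
    and lu: "\<And>b. b \<in> Basis \<Longrightarrow> l \<bullet> b \<le> u \<bullet> b"
  defines "Z \<equiv> (\<lambda>s. x + (\<Sum>b\<in>Basis. (s \<bullet> b) *\<^sub>R e b)) ` box l u"
  shows "Z \<in> lmeasurable" "(\<Prod>b\<in>Basis. u \<bullet> b - l \<bullet> b) \<le> measure lebesgue Z"
proof -
  let ?f = "\<lambda>s. \<Sum>b\<in>Basis. (s \<bullet> b) *\<^sub>R e b"
  have lin: "linear ?f"
    by (rule linearI) (simp_all add: inner_add_left scaleR_add_left sum.distrib scaleR_sum_right)
  have iso: "norm (?f s) = norm s" for s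
  proof -
    have "?f s \<bullet> ?f s = (\<Sum>b\<in>Basis. (s \<bullet> b) * (s \<bullet> b))"
      by (rule inner_orthonormal_sums[OF e]) auto
    also have "\<dots> = s \<bullet> s" by (rule euclidean_inner[symmetric])
    finally show ?thesis by (simp add: norm_eq_sqrt_inner)
  qed
  have Z: "Z = (+) x ` ?f ` box l u" by (auto simp: Z_def)
  show "Z \<in> lmeasurable" unfolding Z
    using measure_isometry_image_ge(1)[OF lin iso, of "box l u"]
    by (intro measurable_translation) auto
  have "(\<Prod>b\<in>Basis. u \<bullet> b - l \<bullet> b) = measure lebesgue (box l u)"
    using lu by (simp add: measure_lborel_box inner_diff_left)
  also have "\<dots> \<le> measure lebesgue Z" unfolding Z measure_translation
    using measure_isometry_image_ge(2)[OF lin iso, of "box l u"] by auto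
  finally show "(\<Prod>b\<in>Basis. u \<bullet> b - l \<bullet> b) \<le> measure lebesgue Z" .
qed

text \<open>Continuity of the partial derivatives makes the operator norm of
  \<open>f' x - f' p\<close> small near \<open>p\<close>; the mean value inequality does the rest.
  Both \<open>y\<close> and \<open>z\<close> vary, whereas differentiability at \<open>p\<close>
  alone would only compare with \<open>p\<close>.\<close>

lemma strict_derivative:
  fixes f :: "'a::euclidean_space \<Rightarrow> 'b::real_normed_vector"
  assumes U: "open U" "p \<in> U" and f: "\<And>x. x \<in> U \<Longrightarrow> (f has_derivative f' x) (at x)"
    and cont: "\<And>b. b \<in> Basis \<Longrightarrow> continuous_on U (\<lambda>x. f' x b)" and "\<delta> > 0"
  shows "\<exists>\<rho>>0. ball p \<rho> \<subseteq> U \<and>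
    (\<forall>y\<in>ball p \<rho>. \<forall>z\<in>ball p \<rho>. norm (f y - f z - f' p (y - z)) \<le> \<delta> * norm (y - z))"
proof -
  let ?c = "\<delta> / real DIM('a)"
  have c: "?c > 0" using \<open>\<delta> > 0\<close> by simp
  have "\<forall>\<^sub>F x in nhds p. dist (f' x b) (f' p b) < ?c" if "b \<in> Basis" for b
  proof -
    have "isCont (\<lambda>x. f' x b) p" using cont[OF that] U by (simp add: continuous_on_eq_continuous_at)
    then have "((\<lambda>x. f' x b) \<longlongrightarrow> f' p b) (nhds p)" by (simp add: isCont_def tendsto_at_iff_tendsto_nhds[of "\<lambda>x. f' x b"])
    then show ?thesis using c by (rule tendstoD)
  qed
  then have "\<forall>\<^sub>F x in nhds p. (\<forall>b\<in>Basis. dist (f' x b) (f' p b) < ?c) \<and> x \<in> U"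
    using U by (intro eventually_conj eventually_ball_finite eventually_nhds_in_open) auto
  then obtain \<rho> where \<rho>: "\<rho> > 0" "\<And>x. dist x p < \<rho> \<Longrightarrow> (\<forall>b\<in>Basis. dist (f' x b) (f' p b) < ?c) \<and> x \<in> U"
    by (auto simp: eventually_nhds_metric)
  have on: "onorm (f' x - f' p) \<le> \<delta>" if x: "x \<in> ball p \<rho>" for x
  proof (rule onorm_le)
    fix v
    have lin: "linear (f' x - f' p)"
      using has_derivative_linear[OF f[of x]] has_derivative_linear[OF f[of p]] \<rho>(2)[of x] x U
      by (simp add: fun_diff_def dist_commute linear_compose_sub)
    have "(f' x - f' p) v = (f' x - f' p) (\<Sum>b\<in>Basis. (v \<bullet> b) *\<^sub>R b)"
      by (simp add: euclidean_representation)
    also have "\<dots> = (\<Sum>b\<in>Basis. (v \<bullet> b) *\<^sub>R (f' x - f' p) b)"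
      by (simp only: linear_sum[OF lin] linear_scale[OF lin])
    also have "norm \<dots> \<le> (\<Sum>b\<in>(Basis::'a set). ?c * norm v)"
    proof (rule sum_norm_le)
      fix b :: 'a assume b: "b \<in> Basis"
      then have "norm ((f' x - f' p) b) \<le> ?c"
        using \<rho>(2)[of x] x by (auto simp: dist_commute dist_norm norm_minus_commute intro: less_imp_le)
      then show "norm ((v \<bullet> b) *\<^sub>R (f' x - f' p) b) \<le> ?c * norm v"
        using Basis_le_norm[OF b, of v] c by (simp only: norm_scaleR real_norm_def mult.commute[of ?c]) (intro mult_mono, auto)
    qed
    also have "\<dots> = \<delta> * norm v" by simp
    finally show "norm ((f' x - f' p) v) \<le> \<delta> * norm v" .
  qed
  have "norm (f y - f z - f' p (y - z)) \<le> norm (y - z) * \<delta>" if "y \<in> ball p \<rho>" "z \<in> ball p \<rho>" for y z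
  proof (rule differentiable_bound_linearization[of z y "ball p \<rho>" f f' p])
    fix t :: real assume "t \<in> {0..1}"
    then show "z + t *\<^sub>R (y - z) \<in> ball p \<rho>"
      using convexD_alt[OF convex_ball that(2,1), of t] by (simp add: algebra_simps)
  next
    fix x assume "x \<in> ball p \<rho>"
    then show "(f has_derivative f' x) (at x within ball p \<rho>)"
      using f \<rho>(2) by (simp add: dist_commute has_derivative_at_withinI)
  qed (use on \<rho> in auto)
  then show ?thesis using \<rho> by (intro exI[of _ \<rho>]) (auto simp: dist_commute mult.commute)
qed

text \<open>The second difference \<open>\<phi>\<close> is symmetric in \<open>u\<close> and
  \<open>v\<close>. The mean value theorem along \<open>v\<close> and strict differentiability of
  \<open>g'\<close> show that it equals \<open>s^2 * g'' p u v\<close> up to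
  \<open>o(s^2)\<close>.\<close>

lemma symmetric_second_derivative:
  fixes g :: "'a::euclidean_space \<Rightarrow> real"
  assumes U: "open U" "p \<in> U"
    and g: "\<And>x. x \<in> U \<Longrightarrow> (g has_derivative blinfun_apply (g' x)) (at x)"
    and g': "\<And>x. x \<in> U \<Longrightarrow> (g' has_derivative blinfun_apply (g'' x)) (at x)"
    and cont: "continuous_on U g''"
  shows "blinfun_apply (g'' p u) v = blinfun_apply (g'' p v) u"
proof -
  define \<phi> where "\<phi> s u v = g (p + s *\<^sub>R u + s *\<^sub>R v) - g (p + s *\<^sub>R u) - g (p + s *\<^sub>R v) + g p"
    for s :: real and u v
  have key: "\<forall>\<^sub>F s in at_right 0. \<bar>\<phi> s u v - s\<^sup>2 * blinfun_apply (g'' p u) v\<bar> \<le> \<delta> * norm u * norm v * s\<^sup>2"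
    if "\<delta> > 0" for u v \<delta>
  proof -
    obtain \<rho> where \<rho>: "\<rho> > 0" "ball p \<rho> \<subseteq> U"
      and st: "\<And>y z. y \<in> ball p \<rho> \<Longrightarrow> z \<in> ball p \<rho> \<Longrightarrow> norm (g' y - g' z - g'' p (y - z)) \<le> \<delta> * norm (y - z)"
      using strict_derivative[OF U g' _ \<open>\<delta> > 0\<close>] cont by (force intro!: continuous_intros)
    define s0 where "s0 = \<rho> / (norm u + norm v + 1)"
    have nn: "norm u + norm v + 1 > 0" by (simp add: add_nonneg_pos)
    then have s0: "s0 > 0" using \<rho> by (simp add: s0_def)
    have "\<bar>\<phi> s u v - s\<^sup>2 * blinfun_apply (g'' p u) v\<bar> \<le> \<delta> * norm u * norm v * s\<^sup>2"
      if s: "0 < s" "s < s0" for s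
    proof -
      have small: "s * norm u + t * norm v < \<rho>" if "0 \<le> t" "t \<le> s" for t
      proof -
        have "s * norm u + t * norm v \<le> s * (norm u + norm v + 1)"
          using mult_right_mono[OF that(2) norm_ge_zero[of v]] s by (simp add: algebra_simps)
        also have "\<dots> < \<rho>" using s nn by (simp add: s0_def pos_less_divide_eq)
        finally show ?thesis .
      qed
      have in1: "p + s *\<^sub>R u + t *\<^sub>R v \<in> ball p \<rho>" if "0 \<le> t" "t \<le> s" for t
      proof -
        have "norm (s *\<^sub>R u + t *\<^sub>R v) \<le> s * norm u + t * norm v"
          using norm_triangle_ineq[of "s *\<^sub>R u" "t *\<^sub>R v"] that s by simp
        then have "dist p (p + (s *\<^sub>R u + t *\<^sub>R v)) < \<rho>"
          using small[OF that] by (simp add: dist_norm del: minus_add_distrib)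
        then show ?thesis by (simp add: add.assoc)
      qed
      have in2: "p + t *\<^sub>R v \<in> ball p \<rho>" if "0 \<le> t" "t \<le> s" for t
      proof -
        have "0 \<le> s * norm u" using s by simp
        then have "t * norm v < \<rho>" using small[OF that] by linarith
        then show ?thesis using that by (simp add: dist_norm)
      qed
      define \<theta> where "\<theta> t = g (p + s *\<^sub>R u + t *\<^sub>R v) - g (p + t *\<^sub>R v)" for t
      let ?\<theta>' = "\<lambda>t. blinfun_apply (g' (p + s *\<^sub>R u + t *\<^sub>R v)) v - blinfun_apply (g' (p + t *\<^sub>R v)) v"
      have der: "(\<theta> has_real_derivative ?\<theta>' t) (at t)" if t: "0 \<le> t" "t \<le> s" for t
      proof -
        have "((\<lambda>t. g (q + t *\<^sub>R v)) has_derivative (\<lambda>h. g' (q + t *\<^sub>R v) (h *\<^sub>R v))) (at t)"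
          if "q + t *\<^sub>R v \<in> U" for q
          by (rule has_derivative_compose[where f = "\<lambda>t. q + t *\<^sub>R v", OF _ g[OF that]]) (auto intro!: derivative_eq_intros)
        then have "((\<lambda>t. g (q + t *\<^sub>R v)) has_real_derivative g' (q + t *\<^sub>R v) v) (at t)"
          if "q + t *\<^sub>R v \<in> U" for q
          using that by (simp add: has_field_derivative_def blinfun.scaleR_right mult.commute[of _ "blinfun_apply _ _"])
        then show ?thesis unfolding \<theta>_def
          using in1[OF t] in2[OF t] \<rho>(2) by (intro DERIV_diff) auto
      qed
      obtain \<xi> where \<xi>: "0 < \<xi>" "\<xi> < s" "\<theta> s - \<theta> 0 = (s - 0) * ?\<theta>' \<xi>"
        using MVT2[of 0 s \<theta> ?\<theta>'] s der by auto
      let ?D = "g' (p + s *\<^sub>R u + \<xi> *\<^sub>R v) - g' (p + \<xi> *\<^sub>R v) - g'' p (s *\<^sub>R u)"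
      have "norm ?D \<le> \<delta> * norm (s *\<^sub>R u)"
        using st[OF in1 in2, of \<xi> \<xi>] \<xi> by (simp add: add.commute add.left_commute)
      then have "\<bar>blinfun_apply ?D v\<bar> \<le> \<delta> * (s * norm u) * norm v"
        using norm_blinfun[of ?D v] s mult_right_mono[of "norm ?D" "\<delta> * norm (s *\<^sub>R u)" "norm v"] by simp
      moreover have "\<phi> s u v - s\<^sup>2 * blinfun_apply (g'' p u) v = s * blinfun_apply ?D v"
        using \<xi>(3) by (simp add: \<theta>_def \<phi>_def blinfun.diff_left blinfun.add_left blinfun.scaleR_left blinfun.scaleR_right
            power2_eq_square algebra_simps)
      ultimately show ?thesis
        using s by (simp add: abs_mult power2_eq_square) (simp add: algebra_simps)
    qed
    then show ?thesis using s0 by (auto simp: eventually_at_right_field)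
  qed
  have "\<bar>blinfun_apply (g'' p u) v - blinfun_apply (g'' p v) u\<bar> \<le> 0 + e" if "e > 0" for e
  proof -
    define \<delta> where "\<delta> = e / (2 * (norm u * norm v + 1))"
    have double_half: "2 * (e / (2 * c)) * c = e" if "c > 0" for c using that by simp
    have nn: "norm u * norm v + 1 > 0" by (simp add: add_nonneg_pos)
    then have \<delta>: "\<delta> > 0" using that by (simp add: \<delta>_def)
    have "\<forall>\<^sub>F s in at_right (0::real). 0 < s" by (simp add: eventually_at_right_less)
    then have "\<forall>\<^sub>F s in at_right 0. 0 < s
        \<and> \<bar>\<phi> s u v - s\<^sup>2 * blinfun_apply (g'' p u) v\<bar> \<le> \<delta> * norm u * norm v * s\<^sup>2
        \<and> \<bar>\<phi> s v u - s\<^sup>2 * blinfun_apply (g'' p v) u\<bar> \<le> \<delta> * norm v * norm u * s\<^sup>2"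
      using key[OF \<delta>, of u v] key[OF \<delta>, of v u] by eventually_elim auto
    then obtain s where s: "0 < s"
        "\<bar>\<phi> s u v - s\<^sup>2 * blinfun_apply (g'' p u) v\<bar> \<le> \<delta> * norm u * norm v * s\<^sup>2"
        "\<bar>\<phi> s v u - s\<^sup>2 * blinfun_apply (g'' p v) u\<bar> \<le> \<delta> * norm v * norm u * s\<^sup>2"
      using eventually_happens'[OF trivial_limit_at_right_real] by blast
    have "\<phi> s u v = \<phi> s v u" by (simp add: \<phi>_def add.commute add.left_commute)
    then have "\<bar>s\<^sup>2 * (blinfun_apply (g'' p u) v - blinfun_apply (g'' p v) u)\<bar> \<le> 2 * (\<delta> * norm v * norm u * s\<^sup>2)"
      using s(2,3) by (simp add: right_diff_distrib mult_ac abs_le_iff)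
    also have "\<dots> = s\<^sup>2 * (2 * \<delta> * (norm u * norm v))" by simp
    finally have "\<bar>blinfun_apply (g'' p u) v - blinfun_apply (g'' p v) u\<bar> \<le> 2 * \<delta> * (norm u * norm v)"
      using s(1) by (simp add: abs_mult)
    also have "\<dots> \<le> 2 * \<delta> * (norm u * norm v + 1)" using \<delta> by simp
    also have "\<dots> = e" unfolding \<delta>_def by (rule double_half[OF nn])
    finally show ?thesis by simp
  qed
  then have "\<bar>blinfun_apply (g'' p u) v - blinfun_apply (g'' p v) u\<bar> \<le> 0"
    by (rule field_le_epsilon)
  then show ?thesis by simp
qed

subsection \<open>The Gauss map\<close>

definition unit_normal :: "'a::real_inner set \<Rightarrow> 'a \<Rightarrow> 'a \<Rightarrow> bool" where
  "unit_normal K x \<nu> \<longleftrightarrow> norm \<nu> = 1 \<and> (\<forall>z\<in>K. \<nu> \<bullet> (z - x) \<le> 0)"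

text \<open>\<open>N\<close> is the normalized gradient of the local defining function, and
  \<open>A\<close> is its Hessian at \<open>p\<close> compressed to the tangent space and divided by
  the length of the gradient. Compression makes \<open>A\<close> symmetric and annihilate the
  normal; it is harmless because boundary chords near \<open>p\<close> are tangential up to a small
  multiple of their length.\<close>

lemma C2_boundary_local_gauss_map:
  fixes K :: "'a::euclidean_space set"
  assumes K: "closed K" "convex K" and C2: "C2_boundary K" and p: "p \<in> frontier K"
  obtains U N A where "open U" "p \<in> U"
    "\<And>x \<nu>. x \<in> frontier K \<inter> U \<Longrightarrow> unit_normal K x \<nu> \<longleftrightarrow> \<nu> = N x"
    "linear A" "\<And>x y. A x \<bullet> y = x \<bullet> A y" "\<And>x. 0 \<le> A x \<bullet> x" "A (N p) = 0"
    "\<And>\<delta>. 0 < \<delta> \<Longrightarrow> \<exists>\<rho>>0. ball p \<rho> \<subseteq> U \<and> (\<forall>y\<in>frontier K \<inter> ball p \<rho>. \<forall>z\<in>frontier K \<inter> ball p \<rho>.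
        norm (N y - N z - A (y - z)) \<le> \<delta> * norm (y - z))"
proof -
  from bspec[OF C2[unfolded C2_boundary_def] p]
  obtain U and g :: "'a \<Rightarrow> real" and g' :: "'a \<Rightarrow> 'a \<Rightarrow>\<^sub>L real" and g'' where C:
    "open U \<and> p \<in> U \<and>
      (\<forall>x\<in>U. (g has_derivative blinfun_apply (g' x)) (at x) \<and> g' x \<noteq> 0 \<and>
              (g' has_derivative blinfun_apply (g'' x)) (at x)) \<and>
      continuous_on U g'' \<and> K \<inter> U = {x \<in> U. g x \<le> 0}"
    by (elim exE)
  have U: "open U" "p \<in> U"
    and g: "\<And>x. x \<in> U \<Longrightarrow> (g has_derivative blinfun_apply (g' x)) (at x)"
    and g0: "\<And>x. x \<in> U \<Longrightarrow> g' x \<noteq> 0"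
    and g': "\<And>x. x \<in> U \<Longrightarrow> (g' has_derivative blinfun_apply (g'' x)) (at x)"
    and cont: "continuous_on U g''" and KU: "K \<inter> U = {x \<in> U. g x \<le> 0}"
    using C by simp_all
  have frK: "x \<in> K" if "x \<in> frontier K" for x
    using that K(1) by (metis closure_closed frontier_def DiffD1)
  define G where "G x = (\<Sum>b\<in>Basis. blinfun_apply (g' x) b *\<^sub>R b)" for x
  define H where "H x v = (\<Sum>b\<in>Basis. blinfun_apply (blinfun_apply (g'' x) v) b *\<^sub>R b)" for x v
  have riesz: "(\<Sum>b\<in>Basis. blinfun_apply f b *\<^sub>R b) \<bullet> v = blinfun_apply f v" for f :: "'a \<Rightarrow>\<^sub>L real" and v
  proof -
    have "blinfun_apply f v = blinfun_apply f (\<Sum>b\<in>Basis. (v \<bullet> b) *\<^sub>R b)"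
      by (simp add: euclidean_representation)
    also have "\<dots> = (\<Sum>b\<in>Basis. (v \<bullet> b) * blinfun_apply f b)"
      by (simp add: blinfun.sum_right blinfun.scaleR_right)
    finally show ?thesis by (simp add: inner_sum_left inner_commute[of v] mult.commute)
  qed
  have G: "G x \<bullet> v = blinfun_apply (g' x) v" for x v unfolding G_def by (rule riesz)
  have H: "H x u \<bullet> v = blinfun_apply (blinfun_apply (g'' x) u) v" for x u v unfolding H_def by (rule riesz)
  have G0: "G x \<noteq> 0" if "x \<in> U" for x
    using g0[OF that] G[of x] by (metis blinfun_eqI inner_zero_left blinfun.zero_left)
  have G': "(G has_derivative H x) (at x)" if "x \<in> U" for x
  proof -
    have "((\<lambda>x. blinfun_apply (g' x) b) has_derivative (\<lambda>v. blinfun_apply (blinfun_apply (g'' x) v) b)) (at x)" for b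
      using g'[OF that] by (auto intro!: derivative_eq_intros)
    then show ?thesis unfolding G_def[abs_def] H_def[abs_def]
      by (intro has_derivative_sum has_derivative_scaleR_left)
  qed
  have along: "((\<lambda>t. g (x + t *\<^sub>R u)) has_real_derivative G (x + t *\<^sub>R u) \<bullet> u) (at t)"
    if "x + t *\<^sub>R u \<in> U" for x u t
  proof -
    have "((\<lambda>t. g (x + t *\<^sub>R u)) has_derivative (\<lambda>h. g' (x + t *\<^sub>R u) (h *\<^sub>R u))) (at t)"
      by (rule has_derivative_compose[where f = "\<lambda>t. x + t *\<^sub>R u", OF _ g[OF that]])
        (auto intro!: derivative_eq_intros)
    then show ?thesis
      by (simp add: has_field_derivative_def G blinfun.scaleR_right mult.commute[of _ "blinfun_apply _ _"])
  qed
  have evU: "\<forall>\<^sub>F t in at_right (0::real). x + t *\<^sub>R u \<in> U" if "x \<in> U" for x u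
  proof -
    have "((\<lambda>t. x + t *\<^sub>R u) \<longlongrightarrow> x + 0 *\<^sub>R u) (at_right 0)"
      by (intro tendsto_intros)
    then show ?thesis using U(1) that by (auto dest: topological_tendstoD)
  qed
  have contg: "continuous_on U g"
    using g by (meson has_derivative_at_withinI has_derivative_continuous_on)
  have int: "x \<in> interior K" if "x \<in> U" "g x < 0" for x
  proof -
    have "open {x \<in> U. g x < 0}"
      using continuous_open_preimage[OF contg U(1), of "{..<0}"] by (simp add: vimage_def Int_def)
    moreover have "{x \<in> U. g x < 0} \<subseteq> K" using KU by force
    ultimately show ?thesis using that interior_maximal by blast
  qed
  have fr0: "g x = 0" if "x \<in> frontier K" "x \<in> U" for x
  proof -
    have "x \<in> K \<inter> U" using frK that by blast
    then have "g x \<le> 0" unfolding KU by simp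
    moreover have "x \<notin> interior K" using that(1) by (simp add: frontier_def)
    ultimately show ?thesis using int[OF that(2)] by fastforce
  qed
  \<comment> \<open>Otherwise \<open>g\<close> would become positive at the start of the segment
    from \<open>x\<close> to \<open>z\<close>, which lies in \<open>K\<close> by convexity.\<close>
  have supp: "G x \<bullet> (z - x) \<le> 0" if x: "x \<in> frontier K" "x \<in> U" and "z \<in> K" for x z
  proof (rule ccontr)
    assume "\<not> ?thesis"
    then have pos: "G (x + 0 *\<^sub>R (z - x)) \<bullet> (z - x) > 0" by simp
    obtain d where d: "d > 0" "\<And>h. 0 < h \<Longrightarrow> h < d \<Longrightarrow> g x < g (x + h *\<^sub>R (z - x))"
      using DERIV_pos_inc_right[OF along pos] x by auto
    have "\<forall>\<^sub>F t in at_right (0::real). 0 < t \<and> t < min d 1"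
      using d(1) by (auto simp: eventually_at_right_field intro!: exI[of _ "min d 1"])
    then have "\<forall>\<^sub>F t in at_right (0::real). False"
      using evU[OF x(2), of "z - x"]
    proof eventually_elim
      case (elim t)
      have "x + t *\<^sub>R (z - x) \<in> K"
        using convexD_alt[OF K(2) frK[OF x(1)] \<open>z \<in> K\<close>, of t] elim by (simp add: algebra_simps)
      then show False using d(2)[of t] elim KU fr0[OF x] by force
    qed
    then show False by simp
  qed
  have desc: "\<forall>\<^sub>F t in at_right (0::real). x + t *\<^sub>R u \<in> K" if x: "x \<in> frontier K" "x \<in> U" and u: "G x \<bullet> u < 0" for x u
  proof -
    have neg: "G (x + 0 *\<^sub>R u) \<bullet> u < 0" using u by simp
    obtain d where d: "d > 0" "\<And>h. 0 < h \<Longrightarrow> h < d \<Longrightarrow> g x > g (x + h *\<^sub>R u)"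
      using DERIV_neg_dec_right[OF along neg] x by auto
    have "\<forall>\<^sub>F t in at_right (0::real). 0 < t \<and> t < d"
      using d(1) by (auto simp: eventually_at_right_field)
    then show ?thesis
      using evU[OF x(2), of u] by eventually_elim (use d(2) KU fr0[OF x] in force)
  qed
  define N where "N x = inverse (norm (G x)) *\<^sub>R G x" for x
  have N1: "norm (N x) = 1" if "x \<in> U" for x using G0[OF that] by (simp add: N_def)
  have Nun: "unit_normal K x (N x)" if "x \<in> frontier K" "x \<in> U" for x
    using supp[OF that] N1[OF that(2)] by (auto simp: unit_normal_def N_def mult_nonneg_nonpos)
  \<comment> \<open>The vector \<open>\<nu> - N x\<close> has negative product with the gradient, so
    it points into \<open>K\<close>, but positive product with \<open>\<nu>\<close>, which an outer
    normal forbids.\<close>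
  have uniq: "\<nu> = N x" if x: "x \<in> frontier K" "x \<in> U" and \<nu>: "unit_normal K x \<nu>" for x \<nu>
  proof (rule ccontr)
    assume ne: "\<nu> \<noteq> N x"
    have n1: "\<nu> \<bullet> \<nu> = 1" "N x \<bullet> N x = 1"
      using \<nu> N1[OF x(2)] by (auto simp: unit_normal_def norm_eq_1)
    have "0 < (\<nu> - N x) \<bullet> (\<nu> - N x)" using ne by simp
    then have lt: "\<nu> \<bullet> N x < 1" using n1 by (simp add: inner_diff_left inner_diff_right inner_commute)
    have "N x \<bullet> (\<nu> - N x) < 0" using lt n1 by (simp add: inner_diff_right inner_commute)
    then have "G x \<bullet> (\<nu> - N x) < 0"
      using G0[OF x(2)] by (simp add: N_def[of x] zero_less_mult_iff mult_less_0_iff)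
    from desc[OF x this] have "\<forall>\<^sub>F t in at_right (0::real). 0 < t \<and> x + t *\<^sub>R (\<nu> - N x) \<in> K"
      by (intro eventually_conj eventually_at_right_less)
    then obtain t where t: "0 < t" "x + t *\<^sub>R (\<nu> - N x) \<in> K"
      using eventually_happens'[OF trivial_limit_at_right_real] by blast
    then have "\<nu> \<bullet> (t *\<^sub>R (\<nu> - N x)) \<le> 0" using \<nu> by (force simp: unit_normal_def)
    then show False using t lt n1 by (simp add: inner_diff_right mult_le_0_iff)
  qed
  \<comment> \<open>Negative curvature along a tangent vector \<open>u\<close> would put a point of
    the tangent plane into the interior of \<open>K\<close>; a small step along the normal would
    then stay in \<open>K\<close> and yet leave the supporting halfspace.\<close>
  have psd: "0 \<le> H p u \<bullet> u" if u: "G p \<bullet> u = 0" for u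
  proof (rule ccontr)
    assume "\<not> ?thesis"
    then have neg: "H p u \<bullet> u < 0" by simp
    have "((\<lambda>t. G (p + t *\<^sub>R u)) has_derivative (\<lambda>h. H (p + 0 *\<^sub>R u) (h *\<^sub>R u))) (at 0)"
      by (rule has_derivative_compose[where f = "\<lambda>t. p + t *\<^sub>R u", OF _ G'])
        (auto intro!: derivative_eq_intros U)
    then have "((\<lambda>t. G (p + t *\<^sub>R u) \<bullet> u) has_derivative (\<lambda>h. H p (h *\<^sub>R u) \<bullet> u)) (at 0)"
      by (auto intro!: derivative_eq_intros)
    then have "((\<lambda>t. G (p + t *\<^sub>R u) \<bullet> u) has_real_derivative H p u \<bullet> u) (at 0)"
      by (simp add: has_field_derivative_def H blinfun.scaleR_right blinfun.scaleR_left mult.commute[of _ "blinfun_apply _ _"])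
    from DERIV_neg_dec_right[OF this neg] obtain d where
      d: "d > 0" "\<And>h. 0 < h \<Longrightarrow> h < d \<Longrightarrow> G (p + h *\<^sub>R u) \<bullet> u < 0"
      using u by auto
    obtain d' where d': "d' > 0" "\<And>h. 0 < h \<Longrightarrow> h < d' \<Longrightarrow> p + h *\<^sub>R u \<in> U"
      using evU[OF U(2), of u] by (auto simp: eventually_at_right_field)
    define t where "t = min d d' / 2"
    have t: "0 < t" "t < d" "t < d'" using d(1) d'(1) by (auto simp: t_def)
    have "p + h *\<^sub>R u \<in> U" if "0 \<le> h" "h \<le> t" for h
      using d'(2)[of h] that t U(2) by (cases "h = 0") auto
    then obtain \<xi> where \<xi>: "0 < \<xi>" "\<xi> < t"
        "g (p + t *\<^sub>R u) - g (p + 0 *\<^sub>R u) = (t - 0) * (G (p + \<xi> *\<^sub>R u) \<bullet> u)"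
      using MVT2[of 0 t "\<lambda>t. g (p + t *\<^sub>R u)" "\<lambda>t. G (p + t *\<^sub>R u) \<bullet> u"] t along by blast
    have "g (p + t *\<^sub>R u) < 0"
      using \<xi> fr0[OF p U(2)] d(2)[of \<xi>] t by (simp add: mult_pos_neg)
    then have "p + t *\<^sub>R u \<in> interior K" using int d'(2)[of t] t by blast
    then obtain \<eta> where \<eta>: "\<eta> > 0" "ball (p + t *\<^sub>R u) \<eta> \<subseteq> K" using mem_interior by blast
    let ?q = "p + t *\<^sub>R u + (\<eta> / 2) *\<^sub>R N p"
    have "?q \<in> K" using \<eta> N1[OF U(2)] by (intro subsetD[OF \<eta>(2)]) (simp add: dist_norm)
    then have "G p \<bullet> (?q - p) \<le> 0" using supp[OF p U(2)] by blast
    moreover have "G p \<bullet> (?q - p) = (\<eta> / 2) * norm (G p)"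
      using u G0[OF U(2)] by (simp add: inner_add_right N_def power2_norm_eq_inner[symmetric] power2_eq_square)
    moreover have "(\<eta> / 2) * norm (G p) > 0" using \<eta>(1) G0[OF U(2)] by simp
    ultimately show False by linarith
  qed
  define N' where "N' x v = inverse (norm (G x)) *\<^sub>R (H x v - (H x v \<bullet> N x) *\<^sub>R N x)" for x v
  have N': "(N has_derivative N' x) (at x)" if "x \<in> U" for x
  proof -
    have "((\<lambda>x. norm (G x)) has_derivative (\<lambda>v. H x v \<bullet> sgn (G x))) (at x)"
      by (rule has_derivative_compose[OF G'[OF that] has_derivative_norm[OF G0[OF that]]])
    then have "((\<lambda>x. inverse (norm (G x)) *\<^sub>R G x) has_derivative
       (\<lambda>v. inverse (norm (G x)) *\<^sub>R H x v
         + (- (inverse (norm (G x)) * (H x v \<bullet> sgn (G x)) * inverse (norm (G x)))) *\<^sub>R G x)) (at x)"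
      using G0[OF that] G'[OF that] by (intro has_derivative_scaleR Deriv.has_derivative_inverse) auto
    then show ?thesis unfolding N_def[abs_def] N'_def
      by (simp add: sgn_div_norm algebra_simps N_def)
  qed
  have contG: "continuous_on U G"
    using G' by (meson has_derivative_at_withinI has_derivative_continuous_on)
  have contN': "continuous_on U (\<lambda>x. N' x b)" for b
    unfolding N'_def N_def H_def using G0 by (intro continuous_intros cont contG) auto
  define n where "n = N p"
  define P where "P v = v - (v \<bullet> n) *\<^sub>R n" for v
  define A where "A v = inverse (norm (G p)) *\<^sub>R P (H p (P v))" for v
  have nn: "n \<bullet> n = 1" using N1[OF U(2)] by (simp add: n_def norm_eq_1)
  have linH: "linear (H p)" using G'[OF U(2)] has_derivative_linear by blast
  have linP: "linear P" unfolding P_def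
    by (rule linearI) (simp_all add: inner_add_left algebra_simps)
  have symP: "P x \<bullet> y = x \<bullet> P y" for x y
    by (simp add: P_def inner_diff_left inner_diff_right inner_commute)
  have symH: "H p x \<bullet> y = x \<bullet> H p y" for x y
    using symmetric_second_derivative[OF U g g' cont, of x y] H[of p x y] H[of p y x] by (simp add: inner_commute)
  have linA: "linear A"
    using linear_compose[OF linear_compose[OF linP linH] linP] linear_compose_scale_right
    unfolding A_def o_def by blast
  have GP: "G p \<bullet> P v = 0" for v
  proof -
    have "G p = norm (G p) *\<^sub>R n" using G0[OF U(2)] by (simp add: n_def N_def)
    moreover have "n \<bullet> P v = 0" using nn by (simp add: P_def inner_diff_right inner_commute)
    ultimately show ?thesis by (metis inner_scaleR_left mult_zero_right)
  qed
  \<comment> \<open>\<open>N' p\<close> and \<open>A\<close> agree on the tangent space, so only the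
    normal component of \<open>v\<close> contributes.\<close>
  have AN: "N' p v - A v = (v \<bullet> n) *\<^sub>R N' p n" for v
  proof -
    have "N' p v = inverse (norm (G p)) *\<^sub>R P (H p v)" for v
      by (simp add: N'_def P_def n_def)
    moreover have "H p v = H p (P v) + (v \<bullet> n) *\<^sub>R H p n"
      using linH by (simp add: P_def linear_diff linear_scale)
    ultimately show ?thesis
      using linP by (simp add: A_def linear_add linear_scale scaleR_add_right)
  qed
  show thesis
  proof (rule that[of U N A])
    show "unit_normal K x \<nu> \<longleftrightarrow> \<nu> = N x" if "x \<in> frontier K \<inter> U" for x \<nu>
      using uniq Nun that by blast
    show "A x \<bullet> y = x \<bullet> A y" for x y by (simp add: A_def symP symH)
    show "0 \<le> A x \<bullet> x" for x using psd[OF GP] by (simp add: A_def symP)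
    have "P n = 0" using nn by (simp add: P_def)
    then show "A (N p) = 0" using linH linP by (simp add: A_def n_def linear_0)
    fix \<delta> :: real assume "0 < \<delta>"
    define C where "C = norm (N' p n) + 1"
    have C: "C > 0" by (simp add: C_def add_nonneg_pos)
    obtain \<rho>1 where \<rho>1: "\<rho>1 > 0" "ball p \<rho>1 \<subseteq> U"
      "\<And>y z. y \<in> ball p \<rho>1 \<Longrightarrow> z \<in> ball p \<rho>1 \<Longrightarrow> norm (N y - N z - N' p (y - z)) \<le> \<delta> / 2 * norm (y - z)"
      using strict_derivative[OF U N' contN', of "\<delta> / 2"] \<open>0 < \<delta>\<close> by auto
    have "isCont N p" using N'[OF U(2)] has_derivative_continuous by blast
    then obtain \<rho>2 where \<rho>2: "\<rho>2 > 0" "\<And>x. dist x p < \<rho>2 \<Longrightarrow> dist (N x) (N p) < \<delta> / (2 * C)"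
      using \<open>0 < \<delta>\<close> C by (metis continuous_at_eps_delta divide_pos_pos mult_pos_pos zero_less_numeral)
    show "\<exists>\<rho>>0. ball p \<rho> \<subseteq> U \<and> (\<forall>y\<in>frontier K \<inter> ball p \<rho>. \<forall>z\<in>frontier K \<inter> ball p \<rho>.
        norm (N y - N z - A (y - z)) \<le> \<delta> * norm (y - z))"
    proof (intro exI[of _ "min \<rho>1 \<rho>2"] conjI ballI)
      fix y z assume y: "y \<in> frontier K \<inter> ball p (min \<rho>1 \<rho>2)" and z: "z \<in> frontier K \<inter> ball p (min \<rho>1 \<rho>2)"
      have close: "norm (N x - n) \<le> \<delta> / (2 * C)" if "x \<in> ball p (min \<rho>1 \<rho>2)" for x
        using \<rho>2(2)[of x] that by (simp add: n_def dist_norm norm_minus_commute[of p] less_imp_le)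
      have ne: "(n - N x) \<bullet> (y - z) \<le> \<delta> / (2 * C) * norm (y - z)" "(N x - n) \<bullet> (y - z) \<le> \<delta> / (2 * C) * norm (y - z)"
        if "x \<in> ball p (min \<rho>1 \<rho>2)" for x
        using close[OF that] norm_cauchy_schwarz[of "n - N x" "y - z"] norm_cauchy_schwarz[of "N x - n" "y - z"]
          mult_right_mono[OF close[OF that] norm_ge_zero[of "y - z"]] by (auto simp: norm_minus_commute)
      have K': "y \<in> K" "z \<in> K" "y \<in> U" "z \<in> U" using y z frK \<rho>1(2) by auto
      \<comment> \<open>The supporting planes at both ends squeeze the component of the chord along
        \<open>n\<close>: replacing \<open>N z\<close> or \<open>N y\<close> by \<open>n\<close>
        costs only the small variation of the normal.\<close>
      have "N z \<bullet> (y - z) \<le> 0" "N y \<bullet> (z - y) \<le> 0"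
        using Nun[of z] Nun[of y] K' y z by (auto simp: unit_normal_def)
      then have "\<bar>(y - z) \<bullet> n\<bar> \<le> \<delta> / (2 * C) * norm (y - z)"
        using ne(1)[of z] ne(2)[of y] y z by (simp add: inner_diff_left inner_diff_right inner_commute abs_le_iff)
      then have "norm (((y - z) \<bullet> n) *\<^sub>R N' p n) \<le> \<delta> / (2 * C) * norm (y - z) * C"
        using C by (simp only: norm_scaleR real_norm_def) (intro mult_mono, auto simp: C_def)
      also have "\<dots> = \<delta> / 2 * norm (y - z)" using C by simp
      finally have "norm (N' p (y - z) - A (y - z)) \<le> \<delta> / 2 * norm (y - z)" by (simp add: AN)
      moreover have "norm (N y - N z - N' p (y - z)) \<le> \<delta> / 2 * norm (y - z)"
        using \<rho>1(3) y z by auto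
      ultimately show "norm (N y - N z - A (y - z)) \<le> \<delta> * norm (y - z)"
        using norm_triangle_ineq[of "N y - N z - N' p (y - z)" "N' p (y - z) - A (y - z)"] by simp
    qed (use \<rho>1 \<rho>2 in auto)
  qed (use U linA in auto)
qed

text \<open>What is kept of \<open>C2_boundary\<close>: unique outer normals, and a Gauss map that
  is strictly differentiable along the boundary with a symmetric positive semidefinite derivative.
  Increments are taken over chords of the ambient space, so no charts appear.\<close>

locale gauss_body =
  fixes K :: "'a::euclidean_space set" and n :: "'a \<Rightarrow> 'a"
  assumes compact_K: "compact K" and convex_K: "convex K" and nonempty_K: "K \<noteq> {}"
    and normal_iff: "x \<in> frontier K \<Longrightarrow> unit_normal K x \<nu> \<longleftrightarrow> \<nu> = n x"
    and strict_shape: "p \<in> frontier K \<Longrightarrow> \<exists>A. linear A \<and> (\<forall>x y. A x \<bullet> y = x \<bullet> A y) \<and> (\<forall>x. 0 \<le> A x \<bullet> x)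
      \<and> A (n p) = 0 \<and> (\<forall>\<delta>>0. \<exists>\<rho>>0. \<forall>y\<in>frontier K \<inter> ball p \<rho>. \<forall>z\<in>frontier K \<inter> ball p \<rho>.
        norm (n y - n z - A (y - z)) \<le> \<delta> * norm (y - z))"
begin

abbreviation "F \<equiv> frontier K"

lemma closed_K: "closed K"
  using compact_K compact_imp_closed by blast

lemma frontier_subset: "F \<subseteq> K"
  using closed_K frontier_subset_closed by blast

lemma norm_n: "x \<in> F \<Longrightarrow> norm (n x) = 1"
  using normal_iff[of x "n x"] by (simp add: unit_normal_def)

lemma inner_n: "x \<in> F \<Longrightarrow> n x \<bullet> n x = 1"
  using norm_n by (simp add: norm_eq_1)

lemma support: "x \<in> F \<Longrightarrow> z \<in> K \<Longrightarrow> n x \<bullet> (z - x) \<le> 0"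
  using normal_iff[of x "n x"] by (simp add: unit_normal_def)

lemma gauss_monotone: "x \<in> F \<Longrightarrow> y \<in> F \<Longrightarrow> 0 \<le> (y - x) \<bullet> (n y - n x)"
  using support[of x y, OF _ subsetD[OF frontier_subset]] support[of y x, OF _ subsetD[OF frontier_subset]]
  by (simp add: inner_diff_left inner_diff_right inner_commute)

lemma closest_point_normal:
  assumes "z \<notin> K"
  shows "closest_point K z \<in> F" "z - closest_point K z = dist z (closest_point K z) *\<^sub>R n (closest_point K z)"
    "dist z (closest_point K z) > 0"
proof -
  let ?y = "closest_point K z"
  define d where "d = norm (z - ?y)"
  define \<nu> where "\<nu> = (1 / d) *\<^sub>R (z - ?y)"
  have y: "?y \<in> K" using closest_point_in_set[OF closed_K nonempty_K] .
  then have d: "d > 0" using assms by (auto simp: d_def)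
  have \<nu>: "norm \<nu> = 1" "z - ?y = d *\<^sub>R \<nu>" using d by (auto simp: \<nu>_def d_def)
  have dot: "\<nu> \<bullet> (x - ?y) \<le> 0" if "x \<in> K" for x
    using closest_point_dot[OF convex_K closed_K that, of z] d by (simp add: \<nu>_def divide_nonpos_pos)
  have "?y \<notin> interior K"
  proof
    assume "?y \<in> interior K"
    then obtain \<eta> where \<eta>: "\<eta> > 0" "ball ?y \<eta> \<subseteq> K" using mem_interior by blast
    then have "?y + (\<eta> / 2) *\<^sub>R \<nu> \<in> K" using \<nu>(1) by (intro subsetD[OF \<eta>(2)]) (simp add: dist_norm)
    from dot[OF this] show False using \<eta>(1) \<nu>(1) by (simp add: norm_eq_1)
  qed
  then show F: "?y \<in> F" using y closed_K by (simp add: frontier_def)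
  have "unit_normal K ?y \<nu>" using \<nu>(1) dot by (simp add: unit_normal_def)
  then have "\<nu> = n ?y" using normal_iff[OF F] by simp
  then show "z - ?y = dist z ?y *\<^sub>R n ?y" "dist z ?y > 0" using \<nu>(2) d by (auto simp: d_def dist_norm)
qed

section \<open>Shape operators with uniform radius and bound\<close>

definition shape_approx :: "real \<Rightarrow> real \<Rightarrow> 'a \<Rightarrow> ('a \<Rightarrow> 'a) \<Rightarrow> bool" where
  "shape_approx \<delta> \<rho> x A \<longleftrightarrow> linear A \<and> (\<forall>u v. A u \<bullet> v = u \<bullet> A v) \<and> (\<forall>v. 0 \<le> A v \<bullet> v) \<and> A (n x) = 0
    \<and> (\<forall>y\<in>F \<inter> ball x \<rho>. \<forall>z\<in>F \<inter> ball x \<rho>. norm (n y - n z - A (y - z)) \<le> \<delta> * norm (y - z))"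

text \<open>The operator at \<open>p\<close> also serves the boundary points \<open>x\<close> near
  \<open>p\<close> once it is compressed to the tangent space at \<open>x\<close>. Compression
  changes it by at most \<open>\<delta> / 2\<close> in norm, since \<open>A\<close> annihilates
  \<open>n p\<close> and \<open>n x\<close> is close to \<open>n p\<close>.\<close>

lemma shape_approx_nearby:
  assumes p: "p \<in> F" and "\<delta> > 0"
  shows "\<exists>\<rho>>0. \<exists>C\<ge>0. \<forall>x\<in>F \<inter> ball p \<rho>. \<exists>A. shape_approx \<delta> \<rho> x A \<and> (\<forall>v. norm (A v) \<le> C * norm v)"
proof -
  obtain A where A: "linear A" "\<And>x y. A x \<bullet> y = x \<bullet> A y" "\<And>x. 0 \<le> A x \<bullet> x" "A (n p) = 0"
    and strict: "\<And>\<delta>. \<delta> > 0 \<Longrightarrow> \<exists>\<rho>>0. \<forall>y\<in>F \<inter> ball p \<rho>. \<forall>z\<in>F \<inter> ball p \<rho>.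
        norm (n y - n z - A (y - z)) \<le> \<delta> * norm (y - z)"
    using strict_shape[OF p] by (elim exE conjE) metis
  obtain C where C: "C > 0" "\<And>v. norm (A v) \<le> C * norm v"
    using linear_bounded_pos[OF A(1)] by blast
  \<comment> \<open>Makes \<open>A (n x)\<close> at most \<open>\<delta> / 4\<close> long; this
    vector enters \<open>A' v - A v\<close> twice.\<close>
  define \<eta> where "\<eta> = \<delta> / (4 * C)"
  have \<eta>: "\<eta> > 0" using \<open>\<delta> > 0\<close> C by (simp add: \<eta>_def)
  obtain \<rho>1 where \<rho>1: "\<rho>1 > 0" "\<And>y z. y \<in> F \<inter> ball p \<rho>1 \<Longrightarrow> z \<in> F \<inter> ball p \<rho>1 \<Longrightarrow>
      norm (n y - n z - A (y - z)) \<le> \<delta> / 2 * norm (y - z)"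
    using strict[of "\<delta> / 2"] \<open>\<delta> > 0\<close> by auto
  define \<rho> where "\<rho> = min (\<rho>1 / 2) (\<eta> / (C + \<delta>))"
  have C\<delta>: "C + \<delta> > 0" using C(1) \<open>\<delta> > 0\<close> by simp
  then have "(C + \<delta>) * \<rho> \<le> (C + \<delta>) * (\<eta> / (C + \<delta>))"
    by (intro mult_left_mono) (auto simp: \<rho>_def)
  then have \<rho>: "\<rho> > 0" "\<rho> \<le> \<rho>1 / 2" "(C + \<delta>) * \<rho> \<le> \<eta>"
    using \<rho>1(1) \<eta> C\<delta> by (auto simp: \<rho>_def min_def)
  have "\<exists>A. shape_approx \<delta> \<rho> x A \<and> (\<forall>v. norm (A v) \<le> C * norm v)" if x: "x \<in> F \<inter> ball p \<rho>" for x
  proof -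
    define P where "P v = v - (v \<bullet> n x) *\<^sub>R n x" for v
    have nx: "n x \<bullet> n x = 1" "norm (n x) = 1" using inner_n norm_n x by auto
    have linP: "linear P" unfolding P_def
      by (rule linearI) (simp_all add: inner_add_left algebra_simps)
    have symP: "P u \<bullet> v = u \<bullet> P v" for u v
      by (simp add: P_def inner_diff_left inner_diff_right inner_commute)
    have normP: "norm (P v) \<le> norm v" for v
    proof -
      have "(norm (P v))\<^sup>2 = (norm v)\<^sup>2 - (v \<bullet> n x)\<^sup>2"
        unfolding P_def power2_norm_eq_inner using nx(1)
        by (simp add: inner_diff_left inner_diff_right inner_commute
            power2_eq_square algebra_simps)
      then have "(norm (P v))\<^sup>2 \<le> (norm v)\<^sup>2" by simp
      then show ?thesis by (simp add: power2_le_iff_abs_le)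
    qed
    have x1: "x \<in> F \<inter> ball p \<rho>1" "p \<in> F \<inter> ball p \<rho>1" using x p \<rho> \<rho>1 by auto
    have "norm (n x - n p) \<le> norm (n x - n p - A (x - p)) + norm (A (x - p))"
      using norm_triangle_ineq[of "n x - n p - A (x - p)" "A (x - p)"] by simp
    also have "\<dots> \<le> \<delta> / 2 * norm (x - p) + C * norm (x - p)"
      using \<rho>1(2)[OF x1] C(2) by (intro add_mono) auto
    also have "\<dots> \<le> (C + \<delta>) * norm (x - p)"
      using \<open>\<delta> > 0\<close> by (simp add: algebra_simps)
    also have "\<dots> \<le> (C + \<delta>) * \<rho>"
      using x C(1) \<open>\<delta> > 0\<close> by (intro mult_left_mono) (auto simp: dist_norm norm_minus_commute)
    finally have "norm (n x - n p) \<le> \<eta>" using \<rho>(3) by simp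
    moreover have "norm (A (n x)) \<le> C * norm (n x - n p)"
      using C(2)[of "n x - n p"] A(1,4) by (simp add: linear_diff)
    ultimately have "norm (A (n x)) \<le> C * \<eta>"
      using C(1) by (meson less_imp_le mult_left_mono order_trans)
    then have An: "norm (A (n x)) \<le> \<delta> / 4" using C(1) by (simp add: \<eta>_def)
    define A' where "A' v = P (A (P v))" for v
    have diff: "norm (A' v - A v) \<le> \<delta> / 2 * norm v" for v
    proof -
      have "A' v - A v = - ((v \<bullet> n x) *\<^sub>R P (A (n x))) - (v \<bullet> A (n x)) *\<^sub>R n x"
        using A(1) linP A(2)[of v "n x"]
        by (simp add: A'_def P_def[of v] linear_diff linear_scale) (simp add: P_def algebra_simps)
      also have "norm \<dots> \<le> norm ((v \<bullet> n x) *\<^sub>R P (A (n x))) + norm ((v \<bullet> A (n x)) *\<^sub>R n x)"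
        using norm_triangle_ineq4 by (metis norm_minus_cancel)
      also have "\<dots> \<le> norm v * (\<delta> / 4) + norm v * (\<delta> / 4)"
      proof (rule add_mono)
        have "\<bar>v \<bullet> n x\<bar> \<le> norm v" using Cauchy_Schwarz_ineq2[of v "n x"] nx by simp
        then show "norm ((v \<bullet> n x) *\<^sub>R P (A (n x))) \<le> norm v * (\<delta> / 4)"
          using normP[of "A (n x)"] An by (simp only: norm_scaleR real_norm_def) (intro mult_mono, auto)
        have "\<bar>v \<bullet> A (n x)\<bar> \<le> norm v * norm (A (n x))" by (rule Cauchy_Schwarz_ineq2)
        also have "\<dots> \<le> norm v * (\<delta> / 4)" using An by (intro mult_left_mono) auto
        finally show "norm ((v \<bullet> A (n x)) *\<^sub>R n x) \<le> norm v * (\<delta> / 4)" using nx by simp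
      qed
      finally show ?thesis by simp
    qed
    have "shape_approx \<delta> \<rho> x A'"
      unfolding shape_approx_def
    proof (intro conjI allI ballI)
      show "linear A'"
        using linear_compose[OF linear_compose[OF linP A(1)] linP] by (simp add: A'_def[abs_def] o_def)
      show "A' u \<bullet> v = u \<bullet> A' v" for u v by (simp add: A'_def symP A(2))
      show "0 \<le> A' v \<bullet> v" for v by (simp add: A'_def symP A(3))
      have "P (n x) = 0" using nx by (simp add: P_def)
      then show "A' (n x) = 0" using A(1) linP by (simp add: A'_def linear_0)
      fix y z assume yz: "y \<in> F \<inter> ball x \<rho>" "z \<in> F \<inter> ball x \<rho>"
      have "ball x \<rho> \<subseteq> ball p \<rho>1"
      proof
        fix q assume "q \<in> ball x \<rho>"
        then show "q \<in> ball p \<rho>1" using x \<rho>(2) dist_triangle[of p q x] by simp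
      qed
      then have "norm (n y - n z - A (y - z)) \<le> \<delta> / 2 * norm (y - z)" using yz \<rho>1(2) by blast
      then show "norm (n y - n z - A' (y - z)) \<le> \<delta> * norm (y - z)"
        using diff[of "y - z"] norm_triangle_ineq4[of "n y - n z - A (y - z)" "A' (y - z) - A (y - z)"] by simp
    qed
    moreover have "norm (A' v) \<le> C * norm v" for v
      using normP[of "A (P v)"] C(2)[of "P v"] mult_left_mono[OF normP[of v], of C] C(1)
      unfolding A'_def by linarith
    ultimately show ?thesis by blast
  qed
  then show ?thesis using \<rho>(1) C(1) by (meson less_imp_le)
qed

lemma shape_approx_mono:
  assumes "shape_approx \<delta> \<rho> x A" "\<rho>' \<le> \<rho>"
  shows "shape_approx \<delta> \<rho>' x A"
  using assms unfolding shape_approx_def by auto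

text \<open>Compactness: the radius and the bound found at \<open>p\<close> are valid for all
  boundary points in the ball of \<open>p\<close>, so finitely many balls suffice. The inserted 1
  keeps the set under \<open>Min\<close> nonempty; summing over \<open>D\<close> is a crude way to
  dominate finitely many constants.\<close>

lemma shape_approx_uniform:
  assumes "\<delta> > 0"
  obtains \<rho> L where "\<rho> > 0" "L \<ge> 0"
    "\<And>x. x \<in> F \<Longrightarrow> \<exists>A. shape_approx \<delta> \<rho> x A \<and> (\<forall>v. norm (A v) \<le> L * norm v)"
proof -
  obtain \<rho> C where \<rho>: "\<And>p. p \<in> F \<Longrightarrow> \<rho> p > 0" "\<And>p. p \<in> F \<Longrightarrow> C p \<ge> 0"
    and loc: "\<And>p x. p \<in> F \<Longrightarrow> x \<in> F \<inter> ball p (\<rho> p) \<Longrightarrow>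
      \<exists>A. shape_approx \<delta> (\<rho> p) x A \<and> (\<forall>v. norm (A v) \<le> C p * norm v)"
    using shape_approx_nearby[OF _ assms] by metis
  have "compact F" using compact_K by (rule compact_frontier)
  then obtain D where D: "D \<subseteq> F" "finite D" "F \<subseteq> (\<Union>p\<in>D. ball p (\<rho> p))"
    using \<rho>(1) by (elim compactE_image[of F F "\<lambda>p. ball p (\<rho> p)"]) force+
  define \<rho>' where "\<rho>' = Min (insert 1 (\<rho> ` D))"
  define L where "L = (\<Sum>p\<in>D. C p)"
  show thesis
  proof (rule that[of \<rho>' L])
    show "\<rho>' > 0" using D \<rho>(1) by (auto simp: \<rho>'_def)
    show "L \<ge> 0" using D \<rho>(2) by (auto simp: L_def intro!: sum_nonneg)
    fix x assume "x \<in> F"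
    then obtain p where p: "p \<in> D" "x \<in> F \<inter> ball p (\<rho> p)" using D(3) by blast
    then obtain A where A: "shape_approx \<delta> (\<rho> p) x A" "\<And>v. norm (A v) \<le> C p * norm v"
      using loc D(1) by blast
    have "\<rho>' \<le> \<rho> p" using p D by (auto simp: \<rho>'_def)
    moreover have "C p \<le> L" using p D \<rho>(2) by (auto simp: L_def intro!: member_le_sum)
    ultimately show "\<exists>A. shape_approx \<delta> \<rho>' x A \<and> (\<forall>v. norm (A v) \<le> L * norm v)"
      using shape_approx_mono[OF A(1)] A(2) by (meson mult_right_mono norm_ge_zero order_trans)
  qed
qed

section \<open>\<open>Q\<close> as an approximate quadratic form\<close>

definition Q :: "real \<Rightarrow> 'a \<Rightarrow> 'a \<Rightarrow> real" where
  "Q R x y = (norm (y - x))\<^sup>2 + R * ((y - x) \<bullet> (n y - n x))"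

lemma norm_le_Q: "R \<ge> 0 \<Longrightarrow> x \<in> F \<Longrightarrow> y \<in> F \<Longrightarrow> (norm (y - x))\<^sup>2 \<le> Q R x y"
  using gauss_monotone by (simp add: Q_def)

text \<open>The error \<open>R * (?e \<bullet> (z - y))\<close> is at most half the squared chord.
  The squared chord is bounded by \<open>Q\<close>, as the Gauss map is monotone, and by the
  quadratic form, as \<open>A\<close> is positive semidefinite; hence each controls the other up to
  3/2.\<close>

lemma Q_approx:
  assumes A: "shape_approx \<delta> \<rho> x A" and R: "R > 0" "\<delta> * R \<le> 1 / 2"
    and y: "y \<in> F \<inter> ball x \<rho>" and z: "z \<in> F \<inter> ball x \<rho>"
  shows "Q R y z \<le> 3 / 2 * ((norm (z - y))\<^sup>2 + R * (A (z - y) \<bullet> (z - y)))"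
    and "(norm (z - y))\<^sup>2 + R * (A (z - y) \<bullet> (z - y)) \<le> 3 / 2 * Q R y z"
proof -
  let ?e = "n z - n y - A (z - y)"
  have "norm ?e \<le> \<delta> * norm (z - y)" using A y z by (simp add: shape_approx_def)
  then have "\<bar>?e \<bullet> (z - y)\<bar> \<le> \<delta> * norm (z - y) * norm (z - y)"
    using Cauchy_Schwarz_ineq2[of ?e "z - y"] by (meson mult_right_mono norm_ge_zero order_trans)
  then have "R * \<bar>?e \<bullet> (z - y)\<bar> \<le> (\<delta> * R) * (norm (z - y))\<^sup>2"
    using R(1) mult_left_mono[of _ _ R] by (fastforce simp: power2_eq_square mult_ac)
  also have "\<dots> \<le> 1 / 2 * (norm (z - y))\<^sup>2" using R(2) by (intro mult_right_mono) auto
  finally have "\<bar>R * (?e \<bullet> (z - y))\<bar> \<le> (norm (z - y))\<^sup>2 / 2" using R(1) by (simp add: abs_mult)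
  moreover have "Q R y z - ((norm (z - y))\<^sup>2 + R * (A (z - y) \<bullet> (z - y))) = R * (?e \<bullet> (z - y))"
    by (simp add: Q_def inner_commute[of "z - y"]) (simp add: inner_diff_left algebra_simps)
  moreover have "(norm (z - y))\<^sup>2 \<le> Q R y z" using norm_le_Q[of R y z] R y z by simp
  moreover have "0 \<le> R * (A (z - y) \<bullet> (z - y))"
    using A R unfolding shape_approx_def by (intro mult_nonneg_nonneg) auto
  moreover have "q \<le> 3 / 2 * (s + t)"
    if "\<bar>e\<bar> \<le> s / 2" "q - (s + t) = e" "s \<le> q" "0 \<le> t" for q s t e :: real
    using that by argo
  moreover have "s + t \<le> 3 / 2 * q"
    if "\<bar>e\<bar> \<le> s / 2" "q - (s + t) = e" "s \<le> q" "0 \<le> t" for q s t e :: real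
    using that by argo
  ultimately show "Q R y z \<le> 3 / 2 * ((norm (z - y))\<^sup>2 + R * (A (z - y) \<bullet> (z - y)))"
    "(norm (z - y))\<^sup>2 + R * (A (z - y) \<bullet> (z - y)) \<le> 3 / 2 * Q R y z" by blast+
qed

text \<open>The parallelogram identity costs a factor 2 for each leg, and passing between
  \<open>Q\<close> and the form \<open>B\<close> costs 3/2 each way: 3/2 * (2 + 2) * 3/2 = 9. The
  operator is the one at the common point \<open>u\<close>, to which both \<open>x\<close> and
  \<open>y\<close> are close.\<close>

lemma Q_quasi_triangle:
  assumes A: "shape_approx \<delta> \<rho> u A" and R: "R > 0" "\<delta> * R \<le> 1 / 2"
    and x: "x \<in> F" and y: "y \<in> F" and u: "u \<in> F" and r: "r < \<rho>" "0 \<le> r"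
    and Q: "Q R x u \<le> r\<^sup>2" "Q R y u \<le> r\<^sup>2"
  shows "Q R x y \<le> 9 * r\<^sup>2" "norm (y - x) \<le> 2 * r"
proof -
  define B where "B v = (norm v)\<^sup>2 + R * (A v \<bullet> v)" for v
  have A': "linear A" "\<And>u v. A u \<bullet> v = u \<bullet> A v" "\<And>v. 0 \<le> A v \<bullet> v"
    using A by (auto simp: shape_approx_def)
  have "(norm (u - x))\<^sup>2 \<le> r\<^sup>2" "(norm (u - y))\<^sup>2 \<le> r\<^sup>2"
    using norm_le_Q[of R x u] norm_le_Q[of R y u] x y u R Q by auto
  then have nr: "norm (u - x) \<le> r" "norm (u - y) \<le> r" using r by (auto simp: power2_le_iff_abs_le)
  then have b: "x \<in> F \<inter> ball u \<rho>" "y \<in> F \<inter> ball u \<rho>" "u \<in> F \<inter> ball u \<rho>"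
    using x y u r by (auto simp: dist_norm)
  show "norm (y - x) \<le> 2 * r"
    using nr norm_triangle_ineq4[of "u - x" "u - y"] by simp
  have nB: "(norm v)\<^sup>2 \<le> B v" for v using A'(3) R by (simp add: B_def)
  have "B (u - x) \<le> 3 / 2 * Q R x u" "B (u - y) \<le> 3 / 2 * Q R y u"
    unfolding B_def by (rule Q_approx(2)[OF A R b(1,3)], rule Q_approx(2)[OF A R b(2,3)])
  moreover have "B (y - x) \<le> 2 * B (u - x) + 2 * B (u - y)"
  proof -
    have "2 * B a + 2 * B b - B (a - b) = B (a + b)" for a b
      using A'(1) by (simp add: B_def linear_add linear_diff power2_norm_eq_inner inner_diff_left inner_diff_right
          inner_add_left inner_add_right algebra_simps)
    from this[of "u - x" "u - y"] have "2 * B (u - x) + 2 * B (u - y) - B (y - x) = B ((u - x) + (u - y))" by simp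
    moreover have "0 \<le> B ((u - x) + (u - y))" using nB by (meson order_trans zero_le_power2)
    ultimately show ?thesis by linarith
  qed
  moreover have "Q R x y \<le> 3 / 2 * B (y - x)"
    unfolding B_def by (rule Q_approx(1)[OF A R b(1,2)])
  ultimately show "Q R x y \<le> 9 * r\<^sup>2" using Q by linarith
qed

text \<open>The last two estimates hold exactly, without any smallness assumption: all the discarded terms are
  nonnegative by monotonicity of the Gauss map.\<close>
lemma foot_point:
  assumes x: "x \<in> F" and t: "t > 0" and w: "n x \<bullet> w = 0" and R: "R \<ge> 0"
  defines "z \<equiv> x + t *\<^sub>R n x + w"
  defines "y \<equiv> closest_point K z"
  shows "z \<notin> K" "y \<in> F" "(norm (y - x))\<^sup>2 \<le> w \<bullet> (y - x)" "norm (y - x) \<le> norm w"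
    "Q R x y \<le> w \<bullet> ((y - x) + R *\<^sub>R (n y - n x))"
    "R \<le> t \<Longrightarrow> Q R x y \<le> w \<bullet> (y - x)"
proof -
  have nz: "n x \<bullet> (z - x) = t" using w inner_n[OF x] by (simp add: z_def inner_add_right)
  then show zK: "z \<notin> K" using support[OF x, of z] t by auto
  show y: "y \<in> F" using closest_point_normal[OF zK] by (simp add: y_def)
  define t' where "t' = dist z y"
  have t': "t' > 0" "z - y = t' *\<^sub>R n y" using closest_point_normal[OF zK] by (auto simp: y_def t'_def)
  define v where "v = y - x"
  have "z = x + v + t' *\<^sub>R n y" using t'(2) by (simp add: v_def algebra_simps)
  then have w': "w = v + t' *\<^sub>R n y - t *\<^sub>R n x" by (simp add: z_def algebra_simps)
  have a: "0 \<le> n y \<bullet> v" "n x \<bullet> v \<le> 0"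
    using support[OF x, of y] support[OF y, of x] frontier_subset x y
    by (auto simp: v_def inner_diff_right)
  \<comment> \<open>Both correction terms have a favourable sign because the tangent planes at
    \<open>x\<close> and \<open>y\<close> support \<open>K\<close>.\<close>
  have wv: "w \<bullet> v = (norm v)\<^sup>2 + t' * (n y \<bullet> v) - t * (n x \<bullet> v)"
    by (simp add: w' inner_diff_left inner_add_left power2_norm_eq_inner)
  have p1: "0 \<le> t' * (n y \<bullet> v)" "t * (n x \<bullet> v) \<le> 0"
    using a t t' by (auto simp: mult_nonneg_nonpos)
  show wv1: "(norm (y - x))\<^sup>2 \<le> w \<bullet> (y - x)" using wv p1 by (simp add: v_def)
  then have "(norm (y - x))\<^sup>2 \<le> norm w * norm (y - x)"
    using norm_cauchy_schwarz[of w "y - x"] by linarith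
  then show "norm (y - x) \<le> norm w"
    by (cases "y = x") (auto simp: power2_eq_square)
  have nn: "n x \<bullet> n y \<le> 1"
    using norm_cauchy_schwarz[of "n x" "n y"] norm_n x y by simp
  have "w \<bullet> (v + R *\<^sub>R (n y - n x)) = w \<bullet> v + R * (v \<bullet> (n y - n x)) + R * ((t' + t) * (1 - n x \<bullet> n y))"
    using inner_n[OF x] inner_n[OF y]
    by (simp add: inner_add_right w' inner_add_left inner_diff_left inner_diff_right inner_commute algebra_simps)
  moreover have "0 \<le> R * ((t' + t) * (1 - n x \<bullet> n y))" using R t t' nn by simp
  ultimately show "Q R x y \<le> w \<bullet> ((y - x) + R *\<^sub>R (n y - n x))"
    using wv1 by (simp add: Q_def v_def)
  assume "R \<le> t"
  \<comment> \<open>The height \<open>t\<close> over the tangent plane at \<open>x\<close> is at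
    most the distance \<open>t'\<close> to \<open>K\<close>, so both weights in \<open>wv\<close>
    may be lowered to \<open>R\<close>.\<close>
  have "t = n x \<bullet> v + t' * (n x \<bullet> n y)"
    using nz \<open>z = _\<close> by (simp add: inner_add_right)
  also have "\<dots> \<le> 0 + t' * 1"
    using a(2) nn t' by (intro add_mono mult_left_mono) auto
  finally have "R \<le> t'" using \<open>R \<le> t\<close> by simp
  then have "R * (n y \<bullet> v) \<le> t' * (n y \<bullet> v)" "t * (n x \<bullet> v) \<le> R * (n x \<bullet> v)"
    using a \<open>R \<le> t\<close> by (auto intro: mult_right_mono mult_right_mono_neg)
  then show "Q R x y \<le> w \<bullet> (y - x)"
    using wv unfolding Q_def v_def[symmetric]
    by (simp add: inner_diff_right inner_commute[of v] right_diff_distrib)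
qed

text \<open>Young's inequality is used with weights that let \<open>Q\<close> absorb everything
  containing \<open>v\<close>: since \<open>B v \<le> 3/2 * Q\<close> and the squared chord is at
  most \<open>Q\<close>, shares 1/8 and 1/12 of \<open>Q\<close> move to the left, leaving
  \<open>19/24 * Q \<le> 15/4 * B w\<close>. Hence the 5 in the bound for \<open>w\<close>.\<close>

lemma foot_of_inner_cell:
  assumes A: "shape_approx \<delta> \<rho> x A" and R: "R > 0" "\<delta> * R \<le> 1 / 2"
    and x: "x \<in> F" and t: "t > 0" and w: "n x \<bullet> w = 0" and "norm w < \<rho>"
    and B: "(norm w)\<^sup>2 + R * (A w \<bullet> w) \<le> r\<^sup>2 / 5"
  shows "Q R x (closest_point K (x + t *\<^sub>R n x + w)) \<le> r\<^sup>2"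
proof -
  define y where "y = closest_point K (x + t *\<^sub>R n x + w)"
  note f = foot_point[OF x t w less_imp_le[OF R(1)], folded y_def]
  have A': "linear A" "\<And>u v. A u \<bullet> v = u \<bullet> A v" "\<And>v. 0 \<le> A v \<bullet> v"
    using A by (auto simp: shape_approx_def)
  define v where "v = y - x"
  define B where "B v = (norm v)\<^sup>2 + R * (A v \<bullet> v)" for v
  have b: "x \<in> F \<inter> ball x \<rho>" "y \<in> F \<inter> ball x \<rho>"
    using x f(2,4) \<open>norm w < \<rho>\<close> le_less_trans[OF norm_ge_zero \<open>norm w < \<rho>\<close>] by (auto simp: dist_norm norm_minus_commute)
  define e where "e = n y - n x - A v"
  have "norm e \<le> \<delta> * norm v" using A b unfolding e_def v_def shape_approx_def by blast
  then have "R * norm e \<le> (\<delta> * R) * norm v" using R mult_left_mono[of "norm e" _ R] by (simp add: mult_ac)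
  also have "\<dots> \<le> 1 / 2 * norm v" using R(2) by (intro mult_right_mono) auto
  finally have e: "R * norm e \<le> norm v / 2" by simp
  have nB: "(norm u)\<^sup>2 \<le> B u" for u using A'(3) R by (simp add: B_def)
  have BQ: "B v \<le> 3 / 2 * Q R x y"
    unfolding B_def v_def by (rule Q_approx(2)[OF A R b])
  have "w \<bullet> (v + R *\<^sub>R (n y - n x)) = (w \<bullet> v + R * (A w \<bullet> v)) + R * (w \<bullet> e)"
    by (simp add: e_def inner_add_right inner_diff_right A'(2) algebra_simps)
  moreover have "w \<bullet> v + R * (A w \<bullet> v) \<le> B v / 12 + 3 * B w"
  proof -
    have "B (v - 6 *\<^sub>R w) = B v - 12 * (w \<bullet> v + R * (A w \<bullet> v)) + 36 * B w"
      using A'(1) A'(2)[of v w]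
      by (simp add: B_def linear_diff linear_scale power2_norm_eq_inner inner_diff_left inner_diff_right
          inner_commute algebra_simps)
    moreover have "0 \<le> B (v - 6 *\<^sub>R w)" using nB[of "v - 6 *\<^sub>R w"] by (meson order_trans zero_le_power2)
    ultimately show ?thesis by simp
  qed
  moreover have "R * (w \<bullet> e) \<le> (norm v)\<^sup>2 / 12 + 3 / 4 * (norm w)\<^sup>2"
  proof -
    have "R * (w \<bullet> e) \<le> norm w * (R * norm e)"
      using norm_cauchy_schwarz[of w e] R(1) by simp
    also have "\<dots> \<le> norm w * (norm v / 2)" using e by (intro mult_left_mono) auto
    also have "\<dots> \<le> (norm v)\<^sup>2 / 12 + 3 / 4 * (norm w)\<^sup>2"
      using zero_le_power2[of "norm v - 3 * norm w"] by (simp add: power2_eq_square algebra_simps)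
    finally show ?thesis .
  qed
  moreover have "Q R x y \<le> w \<bullet> (v + R *\<^sub>R (n y - n x))" using f(5) by (simp add: v_def)
  moreover have "(norm v)\<^sup>2 \<le> Q R x y" using norm_le_Q[of R x y] b R by (simp add: v_def)
  moreover have "B w \<le> r\<^sup>2 / 5" using B by (simp add: B_def)
  moreover have "0 \<le> r\<^sup>2" by simp
  ultimately show ?thesis using BQ nB[of w] unfolding y_def[symmetric] by linarith
qed

text \<open>Writing the displacement as \<open>w = M u\<close> turns \<open>w \<bullet> v\<close>
  into the bilinear form of \<open>M\<close> at \<open>u\<close> and \<open>v\<close>, so it is
  enough to bound \<open>B u\<close>, although \<open>w\<close> may be much longer than
  \<open>u\<close>. The height \<open>t \<ge> R\<close> is what permits the estimate of
  \<open>Q\<close> by \<open>w \<bullet> v\<close> alone.\<close>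

lemma foot_of_outer_cell:
  assumes A: "shape_approx \<delta> \<rho> x A" and R: "R > 0" "\<delta> * R \<le> 1 / 2"
    and x: "x \<in> F" and t: "t \<ge> R" and u: "n x \<bullet> u = 0" and "norm (u + R *\<^sub>R A u) < \<rho>"
    and B: "(norm u)\<^sup>2 + R * (A u \<bullet> u) \<le> r\<^sup>2 / 5"
  shows "Q R x (closest_point K (x + t *\<^sub>R n x + (u + R *\<^sub>R A u))) \<le> r\<^sup>2"
proof -
  define w where "w = u + R *\<^sub>R A u"
  have A': "linear A" "\<And>u v. A u \<bullet> v = u \<bullet> A v" "\<And>v. 0 \<le> A v \<bullet> v" "A (n x) = 0"
    using A by (auto simp: shape_approx_def)
  have w: "n x \<bullet> w = 0" using u A'(2)[of "n x" u] A'(4) by (simp add: w_def inner_add_right)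
  define y where "y = closest_point K (x + t *\<^sub>R n x + w)"
  have "t > 0" using t R by simp
  note f = foot_point[OF x this w less_imp_le[OF R(1)], folded y_def]
  define v where "v = y - x"
  define B where "B v = (norm v)\<^sup>2 + R * (A v \<bullet> v)" for v
  have "norm w < \<rho>" using assms by (simp add: w_def)
  then have b: "x \<in> F \<inter> ball x \<rho>" "y \<in> F \<inter> ball x \<rho>"
    using x f(2,4) le_less_trans[OF norm_ge_zero \<open>norm w < \<rho>\<close>] by (auto simp: dist_norm norm_minus_commute)
  have nB: "(norm u)\<^sup>2 \<le> B u" for u using A'(3) R by (simp add: B_def)
  have BQ: "B v \<le> 3 / 2 * Q R x y"
    unfolding B_def v_def by (rule Q_approx(2)[OF A R b])
  have "w \<bullet> v \<le> B v / 12 + 3 * B u"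
  proof -
    have "B (v - 6 *\<^sub>R u) = B v - 12 * (w \<bullet> v) + 36 * B u"
      using A'(1) A'(2)[of v u]
      by (simp add: B_def w_def linear_diff linear_scale power2_norm_eq_inner inner_diff_left inner_diff_right
          inner_add_left inner_commute algebra_simps)
    moreover have "0 \<le> B (v - 6 *\<^sub>R u)" using nB[of "v - 6 *\<^sub>R u"] by (meson order_trans zero_le_power2)
    ultimately show ?thesis by simp
  qed
  moreover have "Q R x y \<le> w \<bullet> v" using f(6) t by (simp add: v_def)
  moreover have "B u \<le> r\<^sup>2 / 5" using B by (simp add: B_def)
  moreover have "0 \<le> r\<^sup>2" by simp
  ultimately show ?thesis using BQ unfolding y_def[symmetric] w_def[symmetric] by linarith
qed

text \<open>In an eigenframe of \<open>A\<close> the form of \<open>M\<close> is diagonal with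
  entries \<open>m b\<close>. The tangential displacement of the inner box, and the preimage under
  \<open>M\<close> of that of the outer box, both satisfy the bound by \<open>r^2 / 5\<close>. As
  \<open>M\<close> has norm at most \<open>1 + R * L\<close>, the condition on \<open>r\<close>
  keeps all displacements shorter than \<open>\<rho>\<close>.\<close>

lemma dual_cells:
  fixes h r R \<rho> L \<delta> :: real
  assumes A: "shape_approx \<delta> \<rho> x A" and AL: "\<And>v. norm (A v) \<le> L * norm v" and R: "R > 0" "\<delta> * R \<le> 1 / 2"
    and x: "x \<in> F" and r: "r > 0" "r * (1 + R * L) < \<rho>" and h: "h > 0" and L: "L \<ge> 0"
  obtains V W where "V \<in> lmeasurable" "W \<in> lmeasurable"
    "h * R * (4 * r\<^sup>2 / (5 * real DIM('a))) ^ (DIM('a) - 1) \<le> measure lebesgue V * measure lebesgue W"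
    "\<And>z. z \<in> V \<Longrightarrow> z \<notin> K \<and> Q R x (closest_point K z) \<le> r\<^sup>2 \<and> dist x z \<le> h + r"
    "\<And>z. z \<in> W \<Longrightarrow> z \<notin> K \<and> Q R x (closest_point K z) \<le> r\<^sup>2 \<and> dist x z \<le> 2 * R + \<rho>"
proof -
  have A': "linear A" "\<And>u v. A u \<bullet> v = u \<bullet> A v" "\<And>v. 0 \<le> A v \<bullet> v" "A (n x) = 0"
    using A by (auto simp: shape_approx_def)
  obtain e :: "'a \<Rightarrow> 'a" and k b0 where b0: "b0 \<in> Basis" "e b0 = n x"
    and e: "\<And>b c. b \<in> Basis \<Longrightarrow> c \<in> Basis \<Longrightarrow> e b \<bullet> e c = (if b = c then 1 else 0)"
    and k: "\<And>b. b \<in> Basis \<Longrightarrow> A (e b) = k b *\<^sub>R e b"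
  proof (rule symmetric_operator_eigenframe[OF A'(1,2) norm_n[OF x] A'(4)])
    fix e :: "'a \<Rightarrow> 'a" and k b0
    assume "b0 \<in> Basis" "e b0 = n x"
      "\<And>b c. b \<in> Basis \<Longrightarrow> c \<in> Basis \<Longrightarrow> e b \<bullet> e c = (if b = c then 1 else 0)"
      "\<And>b. b \<in> Basis \<Longrightarrow> A (e b) = k b *\<^sub>R e b"
    then show thesis by (rule that[of b0 e k])
  qed
  have k0: "k b \<ge> 0" if "b \<in> Basis" for b
    using A'(3)[of "e b"] k[OF that] e[OF that that] by simp
  define m where "m b = 1 + R * k b" for b
  have m: "m b \<ge> 1" if "b \<in> Basis" for b using k0[OF that] R by (simp add: m_def)
  define S where "S = Basis - {b0}"
  have S: "S \<subseteq> Basis" "finite S" "Basis = insert b0 S" "b0 \<notin> S" using b0 by (auto simp: S_def)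
  have cardS: "card S = DIM('a) - 1" using b0 by (simp add: S_def)
  \<comment> \<open>Each tangential coordinate contributes at most \<open>\<kappa>^2\<close> to the
    quadratic form, and there are at most \<open>DIM('a)\<close> of them, so the total stays below
    \<open>r^2 / 5\<close>.\<close>
  define \<kappa> where "\<kappa> = r / sqrt (5 * real DIM('a))"
  have \<kappa>: "\<kappa> > 0" using r by (simp add: \<kappa>_def)
  have \<kappa>2: "\<kappa>\<^sup>2 = r\<^sup>2 / (5 * real DIM('a))" by (simp add: \<kappa>_def power_divide)
  have sumS: "(\<Sum>b\<in>S. \<kappa>\<^sup>2) \<le> r\<^sup>2 / 5"
  proof -
    have "(\<Sum>b\<in>S. \<kappa>\<^sup>2) \<le> (\<Sum>b\<in>(Basis::'a set). \<kappa>\<^sup>2)" using S by (intro sum_mono2) auto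
    also have "\<dots> = r\<^sup>2 / 5" by (simp add: \<kappa>2)
    finally show ?thesis .
  qed
  define cell where "cell p q a = (\<lambda>s. x + (\<Sum>b\<in>Basis. (s \<bullet> b) *\<^sub>R e b)) `
      box (\<Sum>b\<in>Basis. (if b = b0 then p else - a b) *\<^sub>R b) (\<Sum>b\<in>Basis. (if b = b0 then q else a b) *\<^sub>R b)"
    for p q :: real and a :: "'a \<Rightarrow> real"
  have cellm: "cell p q a \<in> lmeasurable" "(q - p) * (\<Prod>b\<in>S. 2 * a b) \<le> measure lebesgue (cell p q a)"
    if "p \<le> q" "\<And>b. b \<in> S \<Longrightarrow> 0 \<le> a b" for p q a
  proof -
    let ?l = "\<Sum>b\<in>Basis. (if b = b0 then p else - a b) *\<^sub>R b" and ?u = "\<Sum>b\<in>Basis. (if b = b0 then q else a b) *\<^sub>R b"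
    have lu: "?l \<bullet> b \<le> ?u \<bullet> b" if "b \<in> Basis" for b
    proof (cases "b = b0")
      case False
      then have "0 \<le> a b" using \<open>\<And>b. b \<in> S \<Longrightarrow> 0 \<le> a b\<close> that by (simp add: S_def)
      then show ?thesis using that False by simp
    qed (use that \<open>p \<le> q\<close> in simp)
    show "cell p q a \<in> lmeasurable" unfolding cell_def by (rule frame_box_measure(1)[OF e lu])
    have "(\<Prod>b\<in>Basis. ?u \<bullet> b - ?l \<bullet> b) = (\<Prod>b\<in>Basis. if b = b0 then q - p else 2 * a b)"
      by (intro prod.cong) auto
    also have "\<dots> = (q - p) * (\<Prod>b\<in>S. if b = b0 then q - p else 2 * a b)"
      unfolding S(3) using S(2,4) by simp
    also have "(\<Prod>b\<in>S. if b = b0 then q - p else 2 * a b) = (\<Prod>b\<in>S. 2 * a b)"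
      using S by (intro prod.cong) auto
    finally have eq: "(\<Prod>b\<in>Basis. ?u \<bullet> b - ?l \<bullet> b) = (q - p) * (\<Prod>b\<in>S. 2 * a b)" .
    show "(q - p) * (\<Prod>b\<in>S. 2 * a b) \<le> measure lebesgue (cell p q a)"
      unfolding cell_def eq[symmetric] by (rule frame_box_measure(2)[OF e lu])
  qed
  have cellE: "\<exists>t f. z = x + t *\<^sub>R n x + (\<Sum>b\<in>S. f b *\<^sub>R e b) \<and> p < t \<and> t < q \<and> (\<forall>b\<in>S. \<bar>f b\<bar> \<le> a b)"
    if z: "z \<in> cell p q a" for z p q a
  proof -
    obtain s where s: "s \<in> box (\<Sum>b\<in>Basis. (if b = b0 then p else - a b) *\<^sub>R b) (\<Sum>b\<in>Basis. (if b = b0 then q else a b) *\<^sub>R b)"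
      "z = x + (\<Sum>b\<in>Basis. (s \<bullet> b) *\<^sub>R e b)"
      using z unfolding cell_def by (elim imageE) blast
    have "(\<Sum>b\<in>Basis. (s \<bullet> b) *\<^sub>R e b) = (s \<bullet> b0) *\<^sub>R n x + (\<Sum>b\<in>S. (s \<bullet> b) *\<^sub>R e b)"
      unfolding S(3) using S(2,4) b0(2) by simp
    moreover have box: "\<forall>b\<in>Basis. (if b = b0 then p else - a b) < s \<bullet> b \<and> s \<bullet> b < (if b = b0 then q else a b)"
      using s(1) by (simp add: mem_box)
    moreover have "p < s \<bullet> b0 \<and> s \<bullet> b0 < q" using bspec[OF box b0(1)] by simp
    moreover have "\<bar>s \<bullet> b\<bar> \<le> a b" if "b \<in> S" for b
    proof -
      have "b \<in> Basis" "b \<noteq> b0" using that by (auto simp: S_def)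
      then show ?thesis using bspec[OF box, of b] by auto
    qed
    ultimately show ?thesis using s(2) by (intro exI[of _ "s \<bullet> b0"] exI[of _ "\<lambda>b. s \<bullet> b"]) simp
  qed
  have e0: "e b0 \<bullet> e b = 0" if "b \<in> S" for b
    using e[OF b0(1), of b] that S(1,4) by auto
  have nS: "n x \<bullet> (\<Sum>b\<in>S. f b *\<^sub>R e b) = 0" for f
    unfolding inner_sum_right b0(2)[symmetric] by (intro sum.neutral) (simp add: e0)
  have AS: "A (\<Sum>b\<in>S. f b *\<^sub>R e b) = (\<Sum>b\<in>S. (k b * f b) *\<^sub>R e b)" for f
    unfolding linear_sum[OF A'(1)] linear_scale[OF A'(1)] using k S(1) by (intro sum.cong) (auto simp: mult.commute subset_iff)
  have ip: "(\<Sum>b\<in>S. f b *\<^sub>R e b) \<bullet> (\<Sum>b\<in>S. g b *\<^sub>R e b) = (\<Sum>b\<in>S. f b * g b)" for f g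
    by (rule inner_orthonormal_sums[OF e S(1)])
  have BS: "(norm (\<Sum>b\<in>S. f b *\<^sub>R e b))\<^sup>2 + R * (A (\<Sum>b\<in>S. f b *\<^sub>R e b) \<bullet> (\<Sum>b\<in>S. f b *\<^sub>R e b))
      = (\<Sum>b\<in>S. m b * (f b)\<^sup>2)" for f
    unfolding AS power2_norm_eq_inner ip
    by (simp add: m_def sum_distrib_left power2_eq_square algebra_simps flip: sum.distrib)
  have small: "norm v \<le> r" if "(norm v)\<^sup>2 + R * (A v \<bullet> v) \<le> r\<^sup>2 / 5" for v
  proof -
    have "(norm v)\<^sup>2 \<le> r\<^sup>2"
      using that A'(3)[of v] R zero_le_power2[of r] mult_nonneg_nonneg[of R "A v \<bullet> v"] by linarith
    then show ?thesis using r by (simp add: power2_le_iff_abs_le)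
  qed
  define a where "a b = \<kappa> / sqrt (m b)" for b
  define c where "c b = \<kappa> * sqrt (m b)" for b
  have ac: "0 \<le> a b" "0 \<le> c b" "m b * (a b)\<^sup>2 = \<kappa>\<^sup>2" "(c b)\<^sup>2 / m b = \<kappa>\<^sup>2" "a b * c b = \<kappa>\<^sup>2" if "b \<in> S" for b
  proof -
    have "m b > 0" using m[of b] S(1) that by force
    then show "0 \<le> a b" "0 \<le> c b" "m b * (a b)\<^sup>2 = \<kappa>\<^sup>2" "(c b)\<^sup>2 / m b = \<kappa>\<^sup>2"
      using \<kappa> by (simp_all add: a_def c_def power_divide power_mult_distrib)
    show "a b * c b = \<kappa>\<^sup>2"
      using \<open>m b > 0\<close> by (simp add: a_def c_def power2_eq_square)
  qed
  have sq: "(f b)\<^sup>2 \<le> (d b)\<^sup>2" if "\<bar>f b\<bar> \<le> d b" for f d :: "'a \<Rightarrow> real" and b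
    using power_mono[OF that, of 2] by simp
  show thesis
  proof (rule that[of "cell 0 h a" "cell R (2 * R) c"])
    show "cell 0 h a \<in> lmeasurable" "cell R (2 * R) c \<in> lmeasurable"
      using cellm(1) ac(1,2) h R by auto
    have "h * R * (4 * r\<^sup>2 / (5 * real DIM('a))) ^ (DIM('a) - 1) = h * R * (\<Prod>b\<in>S. 4 * \<kappa>\<^sup>2)"
      using cardS by (simp add: \<kappa>2)
    also have "(\<Prod>b\<in>S. 4 * \<kappa>\<^sup>2) = (\<Prod>b\<in>S. (2 * a b) * (2 * c b))"
      using ac(5) by (intro prod.cong) auto
    also have "h * R * \<dots> = ((h - 0) * (\<Prod>b\<in>S. 2 * a b)) * ((2 * R - R) * (\<Prod>b\<in>S. 2 * c b))"
      by (subst prod.distrib) algebra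
    also have "\<dots> \<le> measure lebesgue (cell 0 h a) * measure lebesgue (cell R (2 * R) c)"
      using cellm(2)[of 0 h a] cellm(2)[of R "2 * R" c] ac(1,2) h R
      by (intro mult_mono) (auto intro!: mult_nonneg_nonneg prod_nonneg)
    finally show "h * R * (4 * r\<^sup>2 / (5 * real DIM('a))) ^ (DIM('a) - 1)
        \<le> measure lebesgue (cell 0 h a) * measure lebesgue (cell R (2 * R) c)" .
  next
    fix z assume "z \<in> cell 0 h a"
    from cellE[OF this] obtain t f where z: "z = x + t *\<^sub>R n x + (\<Sum>b\<in>S. f b *\<^sub>R e b)" "0 < t" "t < h" "\<forall>b\<in>S. \<bar>f b\<bar> \<le> a b"
      by blast
    define w where "w = (\<Sum>b\<in>S. f b *\<^sub>R e b)"
    have "(\<Sum>b\<in>S. m b * (f b)\<^sup>2) \<le> (\<Sum>b\<in>S. m b * (a b)\<^sup>2)"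
    proof (rule sum_mono)
      fix b assume "b \<in> S"
      then show "m b * (f b)\<^sup>2 \<le> m b * (a b)\<^sup>2"
        using m[of b] S(1) z(4) sq[of f b a] by (intro mult_left_mono) (auto dest: subsetD)
    qed
    also have "\<dots> = (\<Sum>b\<in>S. \<kappa>\<^sup>2)" using ac by (intro sum.cong) auto
    finally have B: "(norm w)\<^sup>2 + R * (A w \<bullet> w) \<le> r\<^sup>2 / 5" using sumS by (simp add: BS w_def)
    have wr: "norm w \<le> r" using small[OF B] .
    moreover have "r * 1 \<le> r * (1 + R * L)" using r R L by (intro mult_left_mono) auto
    ultimately have "norm w < \<rho>" using r by linarith
    moreover have nw: "n x \<bullet> w = 0" using nS by (simp add: w_def)
    moreover have "dist x z \<le> h + r"
      using z wr norm_triangle_ineq[of "t *\<^sub>R n x" w] norm_n[OF x]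
      by (simp add: dist_norm w_def[symmetric] add.assoc flip: norm_minus_cancel[of "_ + _"])
    ultimately show "z \<notin> K \<and> Q R x (closest_point K z) \<le> r\<^sup>2 \<and> dist x z \<le> h + r"
      using foot_of_inner_cell[OF A R x z(2) nw _ B] foot_point(1)[OF x z(2) nw less_imp_le[OF R(1)]]
      unfolding z(1) w_def[symmetric] by blast
  next
    fix z assume "z \<in> cell R (2 * R) c"
    from cellE[OF this] obtain t f where z: "z = x + t *\<^sub>R n x + (\<Sum>b\<in>S. f b *\<^sub>R e b)" "R < t" "t < 2 * R" "\<forall>b\<in>S. \<bar>f b\<bar> \<le> c b"
      by blast
    \<comment> \<open>Dividing the coordinates by \<open>m b\<close> inverts \<open>M\<close> on the
      tangent space, so the tangential displacement of \<open>z\<close> is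
      \<open>M u\<close>.\<close>
    define u where "u = (\<Sum>b\<in>S. (f b / m b) *\<^sub>R e b)"
    have mS: "m b > 0" if "b \<in> S" for b using m[of b] that S(1) by force
    have w: "(\<Sum>b\<in>S. f b *\<^sub>R e b) = u + R *\<^sub>R A u"
    proof -
      have "u + R *\<^sub>R A u = (\<Sum>b\<in>S. (f b / m b + R * (k b * (f b / m b))) *\<^sub>R e b)"
        unfolding u_def AS by (simp add: scaleR_sum_right scaleR_add_left sum.distrib)
      also have "\<dots> = (\<Sum>b\<in>S. f b *\<^sub>R e b)"
      proof (rule sum.cong)
        fix b assume "b \<in> S"
        have "f b / m b + R * (k b * (f b / m b)) = m b * (f b / m b)"
          unfolding m_def by (simp add: algebra_simps add_divide_distrib)
        then show "(f b / m b + R * (k b * (f b / m b))) *\<^sub>R e b = f b *\<^sub>R e b"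
          using mS[OF \<open>b \<in> S\<close>] by simp
      qed simp
      finally show ?thesis by simp
    qed
    have "(\<Sum>b\<in>S. m b * (f b / m b)\<^sup>2) \<le> (\<Sum>b\<in>S. (c b)\<^sup>2 / m b)"
    proof (rule sum_mono)
      fix b assume b: "b \<in> S"
      have "m b * (f b / m b)\<^sup>2 = (f b)\<^sup>2 / m b" using mS[OF b] by (simp add: power_divide power2_eq_square)
      also have "\<dots> \<le> (c b)\<^sup>2 / m b"
        using mS[OF b] z(4) b sq[of f b c] by (intro divide_right_mono) auto
      finally show "m b * (f b / m b)\<^sup>2 \<le> (c b)\<^sup>2 / m b" .
    qed
    also have "\<dots> = (\<Sum>b\<in>S. \<kappa>\<^sup>2)" using ac by (intro sum.cong) auto
    finally have B: "(norm u)\<^sup>2 + R * (A u \<bullet> u) \<le> r\<^sup>2 / 5" using sumS by (simp add: BS u_def)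
    have ur: "norm u \<le> r" using small[OF B] .
    have nu: "n x \<bullet> u = 0" using nS by (simp add: u_def)
    have "norm (u + R *\<^sub>R A u) \<le> norm u + R * norm (A u)"
      using norm_triangle_ineq[of u "R *\<^sub>R A u"] R by simp
    also have "\<dots> \<le> norm u + R * (L * norm u)" using AL[of u] R by simp
    also have "\<dots> = norm u * (1 + R * L)" by (simp add: algebra_simps)
    also have "\<dots> \<le> r * (1 + R * L)" using ur R L by (intro mult_right_mono) auto
    finally have wn: "norm (u + R *\<^sub>R A u) < \<rho>" using r by simp
    have nw: "n x \<bullet> (u + R *\<^sub>R A u) = 0" using nS[of f] w by simp
    have "dist x z \<le> 2 * R + \<rho>"
      using z(2,3) R wn norm_triangle_ineq[of "t *\<^sub>R n x" "u + R *\<^sub>R A u"] norm_n[OF x]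
      unfolding z(1) w by (simp add: dist_norm add.assoc flip: norm_minus_cancel[of "_ + _"])
    moreover have "0 < t" using z R by simp
    ultimately show "z \<notin> K \<and> Q R x (closest_point K z) \<le> r\<^sup>2 \<and> dist x z \<le> 2 * R + \<rho>"
      using foot_of_outer_cell[OF A R x less_imp_le[OF z(2)] nu wn B] foot_point(1)[OF x _ nw less_imp_le[OF R(1)], of t]
      unfolding z(1) w by blast
  qed
qed

end

subsection \<open>The circumscribed polytope\<close>

text \<open>Facets can be read off from an irredundant family of halfspaces, so a subfamily of least
  cardinality with the same intersection is taken. As different \<open>x\<close> may yield the same
  halfspace, the family is a set of halfspaces, and \<open>a'\<close>, \<open>b'\<close> pick
  representatives.\<close>

lemma card_facets_le_card_halfspaces:
  fixes a :: "'i \<Rightarrow> 'a::euclidean_space"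
  assumes "finite X" and a: "\<And>x. x \<in> X \<Longrightarrow> a x \<noteq> 0"
    and P: "P = (\<Inter>x\<in>X. {y. a x \<bullet> y \<le> b x})" and "interior P \<noteq> {}"
  shows "card {F. F facet_of P} \<le> card X"
proof -
  define H where "H x = {y. a x \<bullet> y \<le> b x}" for x
  define covers where "covers Y \<longleftrightarrow> Y \<subseteq> X \<and> \<Inter>(H ` Y) = P" for Y
  have "covers X" by (simp add: covers_def P H_def)
  then obtain Y where "covers Y" and least: "\<forall>Z. covers Z \<longrightarrow> card Y \<le> card Z"
    using ex_has_least_nat[of covers X card] by blast
  then have Y: "Y \<subseteq> X" "\<Inter>(H ` Y) = P" by (simp_all add: covers_def)
  have min: "card Y \<le> card Z" if "Z \<subseteq> X" "\<Inter>(H ` Z) = P" for Z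
    using least that by (simp add: covers_def)
  have finY: "finite Y" using Y assms finite_subset by blast
  define a' where "a' h = a (inv_into Y H h)" for h
  define b' where "b' h = b (inv_into Y H h)" for h
  have aff: "affine hull P = UNIV" using affine_hull_nonempty_interior assms by blast
  have "F facet_of P \<longleftrightarrow> (\<exists>h. h \<in> H ` Y \<and> F = P \<inter> {y. a' h \<bullet> y = b' h})" for F
  proof (rule facet_of_polyhedron_explicit)
    show "P = affine hull P \<inter> \<Inter>(H ` Y)" using aff Y by simp
    show "a' h \<noteq> 0 \<and> h = {y. a' h \<bullet> y \<le> b' h}" if "h \<in> H ` Y" for h
    proof -
      have "inv_into Y H h \<in> Y" "H (inv_into Y H h) = h"
        using that by (auto simp: inv_into_into f_inv_into_f)
      then show ?thesis using a Y(1) by (auto simp: a'_def b'_def H_def)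
    qed
    show "P \<subset> affine hull P \<inter> \<Inter>F'" if "F' \<subset> H ` Y" for F'
    proof -
      define Z where "Z = {y \<in> Y. H y \<in> F'}"
      have HZ: "H ` Z = F'" using that by (auto simp: Z_def)
      then have "Z \<subset> Y" using that by (auto simp: Z_def)
      then have "card Z < card Y" using finY psubset_card_mono by blast
      then have "\<Inter>F' \<noteq> P" using min[of Z] HZ \<open>Z \<subset> Y\<close> Y(1) by fastforce
      moreover have "P \<subseteq> \<Inter>F'" using that Y(2) by blast
      ultimately show ?thesis using aff by auto
    qed
  qed (use finY in simp)
  then have "{F. F facet_of P} = (\<lambda>h. P \<inter> {y. a' h \<bullet> y = b' h}) ` H ` Y" by auto
  then have "card {F. F facet_of P} \<le> card (H ` Y)" using finY by (simp add: card_image_le)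
  also have "\<dots> \<le> card Y" using finY by (rule card_image_le)
  also have "\<dots> \<le> card X" using Y(1) assms(1) by (simp add: card_mono)
  finally show ?thesis .
qed

context gauss_body
begin

section \<open>Counting points with disjoint cells\<close>

definition separated :: "real \<Rightarrow> real \<Rightarrow> 'a set \<Rightarrow> bool" where
  "separated R r X \<longleftrightarrow> finite X \<and> X \<subseteq> F \<and>
    (\<forall>x\<in>X. \<forall>y\<in>X. x \<noteq> y \<longrightarrow> \<not> (\<exists>u\<in>F. Q R x u \<le> r\<^sup>2 \<and> Q R y u \<le> r\<^sup>2))"

text \<open>If two boxes of the same kind met in \<open>z\<close>, the closest point of
  \<open>z\<close> would lie in the cells of both points; so they are disjoint. Inner boxes stay
  within \<open>h + r \<le> 2 * h\<close> of \<open>K\<close>, outer ones within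
  \<open>R + 2 * R + \<rho> \<le> 4 * R\<close> of \<open>c0\<close>.\<close>

lemma card_separated_bound:
  fixes h r R \<rho> L \<delta> :: real
  assumes shape: "\<And>x. x \<in> F \<Longrightarrow> \<exists>A. shape_approx \<delta> \<rho> x A \<and> (\<forall>v. norm (A v) \<le> L * norm v)"
    and R: "R > 0" "\<delta> * R \<le> 1 / 2" and r: "r > 0" "r * (1 + R * L) < \<rho>" "r \<le> h" and L: "L \<ge> 0"
    and \<rho>: "\<rho> \<le> R" and K: "K \<subseteq> cball c0 R" and X: "separated R r X"
  shows "(real (card X))\<^sup>2 * (h * R * (4 * r\<^sup>2 / (5 * real DIM('a))) ^ (DIM('a) - 1))
    \<le> (measure lebesgue {z. infdist z K \<le> 2 * h} - measure lebesgue K) * measure lebesgue (cball c0 (4 * R))"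
proof -
  let ?c = "h * R * (4 * r\<^sup>2 / (5 * real DIM('a))) ^ (DIM('a) - 1)"
  have h: "h > 0" using r by simp
  have X': "finite X" "X \<subseteq> F" using X by (auto simp: separated_def)
  define cells where "cells x V W \<longleftrightarrow> V \<in> lmeasurable \<and> W \<in> lmeasurable \<and>
      ?c \<le> measure lebesgue V * measure lebesgue W \<and>
      (\<forall>z\<in>V. z \<notin> K \<and> Q R x (closest_point K z) \<le> r\<^sup>2 \<and> dist x z \<le> h + r) \<and>
      (\<forall>z\<in>W. z \<notin> K \<and> Q R x (closest_point K z) \<le> r\<^sup>2 \<and> dist x z \<le> 2 * R + \<rho>)" for x V W
  have "\<exists>V W. cells x V W" if "x \<in> X" for x
  proof -
    have xF: "x \<in> F" using that X' by blast
    obtain A where A: "shape_approx \<delta> \<rho> x A" "\<And>v. norm (A v) \<le> L * norm v" using shape[OF xF] by blast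
    show ?thesis unfolding cells_def by (rule dual_cells[OF A R xF r(1,2) h L]) blast
  qed
  then obtain V W where "\<And>x. x \<in> X \<Longrightarrow> cells x (V x) (W x)" by metis
  then have VW: "\<And>x. x \<in> X \<Longrightarrow> V x \<in> lmeasurable" "\<And>x. x \<in> X \<Longrightarrow> W x \<in> lmeasurable"
      "\<And>x. x \<in> X \<Longrightarrow> ?c \<le> measure lebesgue (V x) * measure lebesgue (W x)"
    and Vz: "\<And>x z. x \<in> X \<Longrightarrow> z \<in> V x \<Longrightarrow> z \<notin> K \<and> Q R x (closest_point K z) \<le> r\<^sup>2 \<and> dist x z \<le> h + r"
    and Wz: "\<And>x z. x \<in> X \<Longrightarrow> z \<in> W x \<Longrightarrow> z \<notin> K \<and> Q R x (closest_point K z) \<le> r\<^sup>2 \<and> dist x z \<le> 2 * R + \<rho>"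
    unfolding cells_def by blast+
  have disj: "x = y" if "x \<in> X" "y \<in> X" "z \<notin> K" "Q R x (closest_point K z) \<le> r\<^sup>2" "Q R y (closest_point K z) \<le> r\<^sup>2"
    for x y z
    using X closest_point_normal(1)[OF that(3)] that unfolding separated_def by blast
  have "pairwise (\<lambda>x y. disjnt (V x) (V y)) X" "pairwise (\<lambda>x y. disjnt (W x) (W y)) X"
    using disj Vz Wz unfolding pairwise_def disjnt_iff by blast+
  then have sums: "(\<Sum>x\<in>X. measure lebesgue (V x)) = measure lebesgue (\<Union>x\<in>X. V x)"
    "(\<Sum>x\<in>X. measure lebesgue (W x)) = measure lebesgue (\<Union>x\<in>X. W x)"
    using X'(1) VW by (simp_all add: measure_UNION')
  have Km: "K \<in> lmeasurable" "{z. infdist z K \<le> 2 * h} \<in> lmeasurable"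
    using compact_K h by (auto intro!: lmeasurable_compact compact_infdist_le nonempty_K)
  have "measure lebesgue (\<Union>x\<in>X. V x) \<le> measure lebesgue ({z. infdist z K \<le> 2 * h} - K)"
  proof (rule measure_mono_fmeasurable)
    show "(\<Union>x\<in>X. V x) \<subseteq> {z. infdist z K \<le> 2 * h} - K"
    proof clarify
      fix x z assume xz: "x \<in> X" "z \<in> V x"
      have "infdist z K \<le> dist x z" using infdist_le[of x K z] xz X' frontier_subset by (auto simp: dist_commute)
      then show "z \<in> {z. infdist z K \<le> 2 * h} - K" using Vz[OF xz] r by auto
    qed
    show "(\<Union>x\<in>X. V x) \<in> sets lebesgue" using VW(1) X'(1) by (intro sets.finite_UN) auto
  qed (use Km in auto)
  also have "\<dots> = measure lebesgue {z. infdist z K \<le> 2 * h} - measure lebesgue K"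
    using Km h by (intro measurable_measure_Diff) auto
  finally have V: "(\<Sum>x\<in>X. measure lebesgue (V x)) \<le> measure lebesgue {z. infdist z K \<le> 2 * h} - measure lebesgue K"
    using sums by simp
  have "measure lebesgue (\<Union>x\<in>X. W x) \<le> measure lebesgue (cball c0 (4 * R))"
  proof (rule measure_mono_fmeasurable)
    show "(\<Union>x\<in>X. W x) \<subseteq> cball c0 (4 * R)"
    proof clarify
      fix x z assume xz: "x \<in> X" "z \<in> W x"
      have "x \<in> cball c0 R" using K xz(1) X'(2) frontier_subset by blast
      then have "dist c0 x \<le> R" by simp
      then show "z \<in> cball c0 (4 * R)" using Wz[OF xz] \<rho> dist_triangle[of c0 z x] by simp
    qed
    show "(\<Union>x\<in>X. W x) \<in> sets lebesgue" using VW(2) X'(1) by (intro sets.finite_UN) auto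
  qed auto
  then have W: "(\<Sum>x\<in>X. measure lebesgue (W x)) \<le> measure lebesgue (cball c0 (4 * R))" using sums by simp
  have c: "?c \<ge> 0" using h R by simp
  have "real (card X) * sqrt ?c = (\<Sum>x\<in>X. sqrt ?c)" by simp
  also have "\<dots> \<le> (\<Sum>x\<in>X. sqrt (measure lebesgue (V x)) * sqrt (measure lebesgue (W x)))"
    using VW(3) by (intro sum_mono) (simp flip: real_sqrt_mult)
  finally have "(real (card X) * sqrt ?c)\<^sup>2 \<le> (\<Sum>x\<in>X. sqrt (measure lebesgue (V x)) * sqrt (measure lebesgue (W x)))\<^sup>2"
    using c by (intro power_mono) auto
  also have "\<dots> \<le> (\<Sum>x\<in>X. (sqrt (measure lebesgue (V x)))\<^sup>2) * (\<Sum>x\<in>X. (sqrt (measure lebesgue (W x)))\<^sup>2)"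
    by (rule Cauchy_Schwarz_ineq_sum)
  also have "\<dots> = (\<Sum>x\<in>X. measure lebesgue (V x)) * (\<Sum>x\<in>X. measure lebesgue (W x))" by simp
  also have "\<dots> \<le> (measure lebesgue {z. infdist z K \<le> 2 * h} - measure lebesgue K) * measure lebesgue (cball c0 (4 * R))"
    using V W by (intro mult_mono order_trans[OF _ V]) (auto intro!: sum_nonneg)
  finally show ?thesis using c by (simp add: power_mult_distrib)
qed

text \<open>\<open>h\<close> is fixed before \<open>\<epsilon>\<close>, so that it can be chosen
  from the surface area alone; \<open>\<epsilon>0\<close> then makes \<open>r\<close> small relative
  to \<open>h\<close>. Of the two properties of the net, the first keeps \<open>x\<close> near the
  tangent plane at \<open>y\<close>, the second keeps that plane from being too oblique at
  \<open>x\<close>.\<close>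

lemma tangent_net:
  fixes R h :: real
  assumes R: "R > 0" and K: "K \<subseteq> cball c0 R" and h: "h > 0"
  shows "\<exists>\<epsilon>0>0. \<forall>\<epsilon>. 0 < \<epsilon> \<and> \<epsilon> \<le> \<epsilon>0 \<longrightarrow>
    (\<exists>X. finite X \<and> X \<subseteq> F \<and> (\<forall>x\<in>F. \<exists>y\<in>X. n y \<bullet> (y - x) \<le> \<epsilon> / 2 \<and> n y \<bullet> n x \<ge> 1 / 2) \<and>
      (real (card X))\<^sup>2 * (h * R * (4 * (\<epsilon> * R / 18) / (5 * real DIM('a))) ^ (DIM('a) - 1))
      \<le> (measure lebesgue {z. infdist z K \<le> 2 * h} - measure lebesgue K) * measure lebesgue (cball c0 (4 * R)))"
proof -
  define \<delta> where "\<delta> = 1 / (2 * R)"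
  have \<delta>: "\<delta> > 0" "\<delta> * R \<le> 1 / 2" using R by (auto simp: \<delta>_def)
  obtain \<rho>0 L where \<rho>0: "\<rho>0 > 0" and L: "L \<ge> 0"
    and shape0: "\<And>x. x \<in> F \<Longrightarrow> \<exists>A. shape_approx \<delta> \<rho>0 x A \<and> (\<forall>v. norm (A v) \<le> L * norm v)"
    using shape_approx_uniform[OF \<delta>(1)] by blast
  define \<rho> where "\<rho> = min \<rho>0 R"
  have \<rho>: "\<rho> > 0" "\<rho> \<le> R" "\<rho> \<le> \<rho>0" using \<rho>0 R by (auto simp: \<rho>_def)
  have shape: "\<exists>A. shape_approx \<delta> \<rho> x A \<and> (\<forall>v. norm (A v) \<le> L * norm v)" if "x \<in> F" for x
    using shape0[OF that] shape_approx_mono \<rho>(3) by blast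
  \<comment> \<open>In this order: inner boxes stay in the shell; displacements and neighbouring net
    points stay within \<open>\<rho>\<close>; normals at neighbouring points differ by at most
    1.\<close>
  define r0 where "r0 = min h (min (\<rho> / (2 * (1 + R * L) + 2)) (1 / (2 * (\<delta> + L))))"
  have RL: "R * L \<ge> 0" using R L by simp
  have \<delta>L: "\<delta> + L > 0" using \<delta> L by simp
  have den: "2 * (1 + R * L) + 2 > 0" using RL by simp
  have r0: "r0 > 0" using h \<rho>(1) den \<delta>L by (simp add: r0_def)
  have small: "r \<le> h" "r * (1 + R * L) < \<rho>" "2 * r < \<rho>" "(\<delta> + L) * (2 * r) \<le> 1" if "0 < r" "r \<le> r0" for r
  proof -
    show "r \<le> h" using that by (simp add: r0_def)
    have "r \<le> \<rho> / (2 * (1 + R * L) + 2)" using that by (simp add: r0_def)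
    then have a: "r * (2 * (1 + R * L) + 2) \<le> \<rho>" by (simp only: pos_le_divide_eq[OF den])
    have rl: "0 \<le> r * (R * L)" using that RL by simp
    show "r * (1 + R * L) < \<rho>" "2 * r < \<rho>" using a rl that by (simp_all add: algebra_simps)
    have "r \<le> 1 / (2 * (\<delta> + L))" using that by (simp add: r0_def)
    then have "r * (2 * (\<delta> + L)) \<le> 1" using \<delta>L by (subst (asm) pos_le_divide_eq) auto
    then show "(\<delta> + L) * (2 * r) \<le> 1" by (simp add: mult_ac)
  qed
  show ?thesis
  proof (intro exI[of _ "18 * r0\<^sup>2 / R"] conjI allI impI)
    show "18 * r0\<^sup>2 / R > 0" using r0 R by simp
    fix \<epsilon> assume \<epsilon>: "0 < \<epsilon> \<and> \<epsilon> \<le> 18 * r0\<^sup>2 / R"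
    \<comment> \<open>Chosen so that the \<open>9 * r^2\<close> of the quasi-triangle inequality is
      \<open>R * (\<epsilon> / 2)\<close>; the factor 2 pays for the angle between neighbouring
      normals.\<close>
    define r where "r = sqrt (\<epsilon> * R / 18)"
    have r: "r > 0" "r\<^sup>2 = \<epsilon> * R / 18" using \<epsilon> R by (auto simp: r_def)
    have "\<epsilon> * R / 18 \<le> r0\<^sup>2" using \<epsilon> R by (simp add: field_simps)
    then have "r \<le> r0" using r0 by (simp add: r_def real_le_lsqrt)
    note sm = small[OF r(1) this]
    let ?c = "h * R * (4 * r\<^sup>2 / (5 * real DIM('a))) ^ (DIM('a) - 1)"
    let ?T = "(measure lebesgue {z. infdist z K \<le> 2 * h} - measure lebesgue K) * measure lebesgue (cball c0 (4 * R))"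
    have bound: "(real (card X))\<^sup>2 * ?c \<le> ?T" if "separated R r X" for X
      by (rule card_separated_bound[OF shape R \<delta>(2) r(1) sm(2,1) L \<rho>(2) K that])
    have c: "?c > 0" using h R r(1) by simp
    \<comment> \<open>Any bound on the cardinality, however large, guarantees a separated set of
      greatest cardinality; the summand 2 leaves room for strictness.\<close>
    have "\<forall>X. separated R r X \<longrightarrow> card X < nat \<lceil>?T / ?c\<rceil> + 2"
    proof (intro allI impI)
      fix X assume "separated R r X"
      from bound[OF this] have "(real (card X))\<^sup>2 \<le> ?T / ?c" using c by (simp only: pos_le_divide_eq)
      moreover have "real (card X) \<le> (real (card X))\<^sup>2" by (cases "card X") (auto simp: power2_eq_square)
      ultimately have "real (card X) \<le> ?T / ?c" by linarith
      then show "card X < nat \<lceil>?T / ?c\<rceil> + 2" by linarith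
    qed
    moreover have "separated R r {}" by (simp add: separated_def)
    ultimately obtain X where X: "separated R r X" and max: "\<And>Y. separated R r Y \<Longrightarrow> card Y \<le> card X"
      using ex_has_greatest_nat[of "separated R r" "{}" card] by blast
    have X': "finite X" "X \<subseteq> F" using X by (auto simp: separated_def)
    \<comment> \<open>Maximality: the cell of every boundary point meets the cell of some chosen
      point.\<close>
    have near: "\<exists>y\<in>X. \<exists>u\<in>F. Q R x u \<le> r\<^sup>2 \<and> Q R y u \<le> r\<^sup>2" if x: "x \<in> F" for x
    proof (rule ccontr)
      assume neg: "\<not> ?thesis"
      have "Q R x x \<le> r\<^sup>2" by (simp add: Q_def)
      then have "x \<notin> X" using neg x by blast
      moreover have "separated R r (insert x X)"
        using X neg x unfolding separated_def by auto
      from max[OF this] have "card (insert x X) \<le> card X" .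
      ultimately show False using X'(1) by simp
    qed
    have "n y \<bullet> (y - x) \<le> \<epsilon> / 2 \<and> n y \<bullet> n x \<ge> 1 / 2"
      if x: "x \<in> F" and y: "y \<in> F" and u: "u \<in> F" and q: "Q R x u \<le> r\<^sup>2" "Q R y u \<le> r\<^sup>2" for x y u
    proof -
      obtain A where A: "shape_approx \<delta> \<rho> u A" using shape[OF u] by blast
      have r\<rho>: "r < \<rho>" using sm(3) r(1) by simp
      note qt = Q_quasi_triangle[OF A R \<delta>(2) x y u r\<rho> less_imp_le[OF r(1)] q]
      have "R * ((y - x) \<bullet> (n y - n x)) \<le> 9 * r\<^sup>2"
        using qt(1) unfolding Q_def by (smt (verit) zero_le_power2)
      then have "R * ((y - x) \<bullet> (n y - n x)) \<le> R * (\<epsilon> / 2)" unfolding r(2) by simp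
      then have "(y - x) \<bullet> (n y - n x) \<le> \<epsilon> / 2" using R by (simp only: mult_le_cancel_left_pos)
      moreover have "n x \<bullet> (y - x) \<le> 0" using support[OF x] y frontier_subset by blast
      ultimately have 1: "n y \<bullet> (y - x) \<le> \<epsilon> / 2"
        by (simp add: inner_diff_right inner_commute[of "y - x"]) 
      obtain B where B: "shape_approx \<delta> \<rho> x B" "\<And>v. norm (B v) \<le> L * norm v" using shape[OF x] by blast
      have "x \<in> F \<inter> ball x \<rho>" "y \<in> F \<inter> ball x \<rho>"
        using x y qt(2) sm(3) \<rho>(1) by (auto simp: dist_norm norm_minus_commute)
      then have "norm (n y - n x - B (y - x)) \<le> \<delta> * norm (y - x)"
        using B(1) unfolding shape_approx_def by blast
      then have "norm (n y - n x) \<le> \<delta> * norm (y - x) + L * norm (y - x)"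
        using norm_triangle_ineq[of "n y - n x - B (y - x)" "B (y - x)"] B(2)[of "y - x"] by simp
      also have "\<dots> = (\<delta> + L) * norm (y - x)" by (simp add: algebra_simps)
      also have "\<dots> \<le> (\<delta> + L) * (2 * r)" using qt(2) \<delta>L by (intro mult_left_mono) auto
      finally have "norm (n y - n x) \<le> 1" using sm(4) by simp
      then have "(norm (n y - n x))\<^sup>2 \<le> 1" by (simp add: power_le_one)
      \<comment> \<open>Unit vectors at distance at most 1 enclose an angle of at most 60
        degrees.\<close>
      then have "n y \<bullet> n x \<ge> 1 / 2"
        using inner_n[OF x] inner_n[OF y]
        by (simp add: power2_norm_eq_inner inner_diff_left inner_diff_right inner_commute)
      with 1 show ?thesis by simp
    qed
    then have "\<forall>x\<in>F. \<exists>y\<in>X. n y \<bullet> (y - x) \<le> \<epsilon> / 2 \<and> n y \<bullet> n x \<ge> 1 / 2"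
      using near X'(2) by (meson subsetD)
    then show "\<exists>X. finite X \<and> X \<subseteq> F \<and> (\<forall>x\<in>F. \<exists>y\<in>X. n y \<bullet> (y - x) \<le> \<epsilon> / 2 \<and> n y \<bullet> n x \<ge> 1 / 2) \<and>
      (real (card X))\<^sup>2 * (h * R * (4 * (\<epsilon> * R / 18) / (5 * real DIM('a))) ^ (DIM('a) - 1)) \<le> ?T"
      using X' bound[OF X] unfolding r(2) by blast
  qed
qed

text \<open>A point of \<open>P\<close> outside \<open>K\<close> is its closest point
  \<open>p\<close> plus \<open>d\<close> times the normal there. Some halfspace allows a gain of at
  most \<open>\<epsilon> / 2\<close> in its own normal direction, and the cosine 1/2 turns this into
  \<open>d \<le> \<epsilon>\<close>. Boundedness of \<open>P\<close> is a consequence of this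
  estimate.\<close>

lemma tangent_polytope:
  assumes X: "finite X" "X \<subseteq> F" and "\<epsilon> > 0" and "interior K \<noteq> {}"
    and net: "\<And>x. x \<in> F \<Longrightarrow> \<exists>y\<in>X. n y \<bullet> (y - x) \<le> \<epsilon> / 2 \<and> n y \<bullet> n x \<ge> 1 / 2"
  shows "\<exists>P. polytope P \<and> K \<subseteq> P \<and> hausdorff_dist K P \<le> \<epsilon> \<and> card {C. C facet_of P} \<le> card X"
proof -
  define P where "P = (\<Inter>x\<in>X. {y. n x \<bullet> y \<le> n x \<bullet> x})"
  have KP: "K \<subseteq> P"
    using support X(2) by (force simp: P_def inner_diff_right)
  have close: "infdist y K \<le> \<epsilon>" if y: "y \<in> P" for y
  proof (cases "y \<in> K")
    case False
    define p where "p = closest_point K y"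
    define d where "d = dist y p"
    have p: "p \<in> F" "y - p = d *\<^sub>R n p" "d > 0" using closest_point_normal[OF False] by (auto simp: p_def d_def)
    obtain x where x: "x \<in> X" "n x \<bullet> (x - p) \<le> \<epsilon> / 2" "n x \<bullet> n p \<ge> 1 / 2" using net[OF p(1)] by blast
    have "n x \<bullet> (p + d *\<^sub>R n p) \<le> n x \<bullet> x" using y x(1) p(2) by (auto simp: P_def algebra_simps)
    then have "d * (n x \<bullet> n p) \<le> \<epsilon> / 2" using x(2) by (simp add: inner_add_right inner_diff_right)
    moreover have "d * (1 / 2) \<le> d * (n x \<bullet> n p)" using x(3) p(3) by (intro mult_left_mono) auto
    ultimately have "d \<le> \<epsilon>" by simp
    moreover have "infdist y K \<le> d"
      using p(1) frontier_subset by (auto simp: d_def intro: infdist_le)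
    ultimately show ?thesis by simp
  qed (use \<open>\<epsilon> > 0\<close> in simp)
  have "bounded P"
    using close
    by (intro bounded_subset[OF compact_imp_bounded[OF compact_infdist_le[OF nonempty_K compact_K \<open>\<epsilon> > 0\<close>]]]) auto
  moreover have "polyhedron P"
    unfolding P_def using X(1) by (intro polyhedron_Inter) (auto simp: polyhedron_halfspace_le)
  ultimately have "polytope P" by (simp add: polytope_eq_bounded_polyhedron)
  moreover have "hausdorff_dist K P \<le> \<epsilon>"
  proof -
    have "(SUP x\<in>K. infdist x P) \<le> \<epsilon>"
      using nonempty_K KP \<open>\<epsilon> > 0\<close> by (intro cSUP_least) auto
    moreover have "(SUP y\<in>P. infdist y K) \<le> \<epsilon>"
      using nonempty_K KP close by (intro cSUP_least) auto
    ultimately show ?thesis by (simp add: hausdorff_dist_def)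
  qed
  moreover have "card {C. C facet_of P} \<le> card X"
  proof (rule card_facets_le_card_halfspaces[OF X(1) _ P_def])
    show "n x \<noteq> 0" if "x \<in> X" for x using norm_n[of x] X(2) that by auto
    show "interior P \<noteq> {}" using interior_mono[OF KP] assms(4) by blast
  qed
  ultimately show ?thesis using KP by blast
qed

end

text \<open>The local Gauss maps agree on overlaps because outer unit normals are unique, so
  \<open>THE\<close> glues them into one global map.\<close>

lemma gauss_body_if_C2_boundary:
  assumes "convex_body K" "C2_boundary K"
  shows "gauss_body K (\<lambda>x. THE \<nu>. unit_normal K x \<nu>)"
proof -
  have K: "compact K" "closed K" "convex K" "K \<noteq> {}"
    using assms(1) interior_subset compact_imp_closed by (auto simp: convex_body_def)
  let ?n = "\<lambda>x. THE \<nu>. unit_normal K x \<nu>"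
  have n: "unit_normal K x \<nu> \<longleftrightarrow> \<nu> = ?n x" if x: "x \<in> frontier K" for x \<nu>
  proof -
    obtain N U where "x \<in> U" "\<And>x \<nu>. x \<in> frontier K \<inter> U \<Longrightarrow> unit_normal K x \<nu> \<longleftrightarrow> \<nu> = N x"
      using C2_boundary_local_gauss_map[OF K(2,3) assms(2) x] by metis
    then have "unit_normal K x \<nu> \<longleftrightarrow> \<nu> = N x" for \<nu> using x by blast
    then show ?thesis by simp
  qed
  show ?thesis
  proof
    show "compact K" "convex K" "K \<noteq> {}" by (fact K)+
    show "unit_normal K x \<nu> \<longleftrightarrow> \<nu> = ?n x" if "x \<in> frontier K" for x \<nu>
      using that by (rule n)
    fix p assume p: "p \<in> frontier K"
    obtain U N A where U: "open U" "p \<in> U" and N: "\<And>x \<nu>. x \<in> frontier K \<inter> U \<Longrightarrow> unit_normal K x \<nu> \<longleftrightarrow> \<nu> = N x"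
      and A: "linear A" "\<And>x y. A x \<bullet> y = x \<bullet> A y" "\<And>x. 0 \<le> A x \<bullet> x" "A (N p) = 0"
      and strict: "\<And>\<delta>. 0 < \<delta> \<Longrightarrow> \<exists>\<rho>>0. ball p \<rho> \<subseteq> U \<and> (\<forall>y\<in>frontier K \<inter> ball p \<rho>. \<forall>z\<in>frontier K \<inter> ball p \<rho>.
        norm (N y - N z - A (y - z)) \<le> \<delta> * norm (y - z))"
    proof (rule C2_boundary_local_gauss_map[OF K(2,3) assms(2) p])
      fix U N A
      assume "open U" "p \<in> U" "\<And>x \<nu>. x \<in> frontier K \<inter> U \<Longrightarrow> unit_normal K x \<nu> \<longleftrightarrow> \<nu> = N x"
        "linear A" "\<And>x y. A x \<bullet> y = x \<bullet> A y" "\<And>x. 0 \<le> A x \<bullet> x" "A (N p) = 0"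
        "\<And>\<delta>. 0 < \<delta> \<Longrightarrow> \<exists>\<rho>>0. ball p \<rho> \<subseteq> U \<and> (\<forall>y\<in>frontier K \<inter> ball p \<rho>. \<forall>z\<in>frontier K \<inter> ball p \<rho>.
          norm (N y - N z - A (y - z)) \<le> \<delta> * norm (y - z))"
      then show thesis by (rule that[of U N A])
    qed
    have eq: "?n x = N x" if "x \<in> frontier K" "x \<in> U" for x using n[OF that(1)] N[of x] that by blast
    have "\<exists>\<rho>>0. \<forall>y\<in>frontier K \<inter> ball p \<rho>. \<forall>z\<in>frontier K \<inter> ball p \<rho>.
        norm (?n y - ?n z - A (y - z)) \<le> \<delta> * norm (y - z)" if \<delta>: "\<delta> > 0" for \<delta>
    proof -
      obtain \<rho> where \<rho>: "\<rho> > 0" "ball p \<rho> \<subseteq> U" "\<forall>y\<in>frontier K \<inter> ball p \<rho>. \<forall>z\<in>frontier K \<inter> ball p \<rho>.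
        norm (N y - N z - A (y - z)) \<le> \<delta> * norm (y - z)"
        using strict[OF \<delta>] by blast
      have "?n y = N y" if "y \<in> frontier K \<inter> ball p \<rho>" for y using eq that \<rho>(2) by blast
      then show ?thesis using \<rho>(1,3) by (intro exI[of _ \<rho>]) simp
    qed
    then show "\<exists>A. linear A \<and> (\<forall>x y. A x \<bullet> y = x \<bullet> A y) \<and> (\<forall>x. 0 \<le> A x \<bullet> x) \<and> A (?n p) = 0 \<and>
      (\<forall>\<delta>>0. \<exists>\<rho>>0. \<forall>y\<in>frontier K \<inter> ball p \<rho>. \<forall>z\<in>frontier K \<inter> ball p \<rho>.
        norm (?n y - ?n z - A (y - z)) \<le> \<delta> * norm (y - z))"
      using A eq[OF p U(2)] by (intro exI[of _ A]) simp
  qed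
qed

section \<open>Cancellation of \<open>R\<close> and \<open>h\<close>, and the choice of the
  constant\<close>

lemma facet_count_algebra:
  fixes N h R \<epsilon> S B :: real and d :: nat
  assumes pos: "h > 0" "R > 0" "\<epsilon> > 0" "d > 0"
    and le: "N\<^sup>2 * (h * R * (4 * (\<epsilon> * R / 18) / (5 * real d)) ^ (d - 1)) \<le> (4 * h * S) * ((4 * R) ^ d * B)"
  shows "N\<^sup>2 \<le> 4 * 4 ^ d * B * (45 * real d / 2) ^ (d - 1) * S / \<epsilon> ^ (d - 1)"
proof -
  let ?m = "45 * real d / 2"
  have m: "?m > 0" using pos by simp
  have e: "4 * (\<epsilon> * R / 18) / (5 * real d) = \<epsilon> * R / ?m" using pos by (simp add: field_simps)
  have d: "R ^ d = R * R ^ (d - 1)" using pos(4) by (cases d) auto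
  have "N\<^sup>2 * (h * R * (\<epsilon> ^ (d - 1) * R ^ (d - 1) / ?m ^ (d - 1))) \<le> (4 * h * S) * (4 ^ d * (R * R ^ (d - 1)) * B)"
    using le unfolding e power_divide power_mult_distrib d .
  \<comment> \<open>One factor \<open>R\<close> comes from the height of the outer box and
    \<open>R ^ (d - 1)\<close> from the choice of \<open>r\<close>; together they match the volume
    of the large ball, so nothing depending on \<open>R\<close> survives.\<close>
  then have "(h * R * R ^ (d - 1)) * (N\<^sup>2 * (\<epsilon> ^ (d - 1) / ?m ^ (d - 1))) \<le> (h * R * R ^ (d - 1)) * (4 * 4 ^ d * B * S)"
    by (simp only: mult_ac times_divide_eq_right times_divide_eq_left)
  moreover have "h * R * R ^ (d - 1) > 0" using pos by simp
  ultimately have "N\<^sup>2 * (\<epsilon> ^ (d - 1) / ?m ^ (d - 1)) \<le> 4 * 4 ^ d * B * S"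
    by (simp only: mult_le_cancel_left_pos)
  then have "N\<^sup>2 * \<epsilon> ^ (d - 1) \<le> 4 * 4 ^ d * B * S * ?m ^ (d - 1)"
    using m by (simp only: times_divide_eq_right pos_divide_le_eq zero_less_power)
  then show ?thesis using pos(3) by (simp only: pos_le_divide_eq zero_less_power mult_ac)
qed

theorem theorem2:
  assumes "DIM('a::euclidean_space) \<ge> 2"
  shows "\<exists>c>0. \<forall>K::'a set. convex_body K \<and> C2_boundary K \<longrightarrow>
           (\<exists>\<epsilon>0>0. \<forall>\<epsilon>. 0 < \<epsilon> \<and> \<epsilon> \<le> \<epsilon>0 \<longrightarrow>
              (\<exists>P. polytope P \<and> K \<subseteq> P \<and> hausdorff_dist K P \<le> \<epsilon> \<and>
                   real (card {F. F facet_of P})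
                     \<le> (c * surface_diameter K / \<epsilon>) powr ((real DIM('a) - 1) / 2)))"
proof -
  let ?d = "DIM('a)"
  define B where "B = measure lebesgue (ball (0::'a) 1)"
  have B: "B > 0" by (simp add: B_def content_ball_pos)
  define M where "M = 4 * 4 ^ ?d * B * (45 * real ?d / 2) ^ (?d - 1)"
  have M: "M > 0" using B by (simp add: M_def)
  define s where "s = surface_area (cball (0::'a) 1)"
  have "convex_body (cball (0::'a) 1)" by (simp add: convex_body_def)
  then have s: "s > 0" unfolding s_def by (rule surface_area_limit(2))
  define q where "q = real ?d - 1"
  have q: "q > 0" "q = real (?d - 1)" using assms by (auto simp: q_def)
  \<comment> \<open>Solves \<open>c * surface_diameter K = (M * S) powr (1 / q)\<close> for
    \<open>c\<close>, with \<open>S\<close> the surface area of \<open>K\<close>: \<open>s\<close>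
    cancels the area of the unit ball, and the division by 2 cancels the factor 2 of the
    diameter.\<close>
  define c where "c = (M * s) powr (1 / q) / 2"
  have c: "c > 0" using M s by (simp add: c_def)
  show ?thesis
  proof (rule exI[of _ c], rule conjI[OF c], intro allI impI)
    fix K :: "'a set" assume K: "convex_body K \<and> C2_boundary K"
    interpret gauss_body K "\<lambda>x. THE \<nu>. unit_normal K x \<nu>"
      using gauss_body_if_C2_boundary K by blast
    define S where "S = surface_area K"
    have S: "S > 0" unfolding S_def using K by (intro surface_area_limit(2)) simp
    let ?g = "\<lambda>e. measure lebesgue {x. infdist x K \<le> e} - measure lebesgue K"
    have "((\<lambda>e. ?g e / e) \<longlongrightarrow> S) (at_right 0)"
      unfolding S_def using K by (intro surface_area_limit(1)) simp
    \<comment> \<open>The shell quotient tends to \<open>S > 0\<close>, so it falls below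
      \<open>2 * S\<close> for some \<open>e\<close> depending on \<open>K\<close>. This dependence
      is harmless because \<open>h = e / 2\<close> cancels in the count; the shell used there has
      width \<open>2 * h\<close>.\<close>
    then have "\<forall>\<^sub>F e in at_right 0. ?g e / e < 2 * S"
      using S by (intro order_tendstoD(2)) auto
    then have "\<forall>\<^sub>F e in at_right 0. 0 < e \<and> ?g e / e < 2 * S"
      by (intro eventually_conj eventually_at_right_less)
    then obtain e where e: "0 < e" "?g e / e < 2 * S"
      using eventually_happens'[OF trivial_limit_at_right_real] by blast
    define h where "h = e / 2"
    have h: "h > 0" using e by (simp add: h_def)
    have gh: "?g (2 * h) \<le> 4 * h * S" using e by (simp add: h_def field_simps)
    obtain R where R: "R > 0" "K \<subseteq> cball 0 R"
      using bounded_subset_ballD[OF compact_imp_bounded[OF compact_K], of 0] ball_subset_cball by (metis subset_trans)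
    have cb: "measure lebesgue (cball (0::'a) (4 * R)) = (4 * R) ^ ?d * B"
      using R content_ball_conv_unit_ball[of "4 * R" "0::'a"] content_cball_conv_ball[of "0::'a" "4 * R"]
      by (simp add: B_def)
    from tangent_net[OF R h] obtain \<epsilon>0 where \<epsilon>0: "\<epsilon>0 > 0"
      and net: "\<And>\<epsilon>. 0 < \<epsilon> \<Longrightarrow> \<epsilon> \<le> \<epsilon>0 \<Longrightarrow> \<exists>X. finite X \<and> X \<subseteq> F \<and>
        (\<forall>x\<in>F. \<exists>y\<in>X. (THE \<nu>. unit_normal K y \<nu>) \<bullet> (y - x) \<le> \<epsilon> / 2 \<and>
          (THE \<nu>. unit_normal K y \<nu>) \<bullet> (THE \<nu>. unit_normal K x \<nu>) \<ge> 1 / 2) \<and>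
        (real (card X))\<^sup>2 * (h * R * (4 * (\<epsilon> * R / 18) / (5 * real ?d)) ^ (?d - 1))
        \<le> ?g (2 * h) * ((4 * R) ^ ?d * B)"
      unfolding cb by blast
    show "\<exists>\<epsilon>0>0. \<forall>\<epsilon>. 0 < \<epsilon> \<and> \<epsilon> \<le> \<epsilon>0 \<longrightarrow>
              (\<exists>P. polytope P \<and> K \<subseteq> P \<and> hausdorff_dist K P \<le> \<epsilon> \<and>
                   real (card {F. F facet_of P}) \<le> (c * surface_diameter K / \<epsilon>) powr ((real ?d - 1) / 2))"
    proof (intro exI[of _ \<epsilon>0] conjI allI impI \<epsilon>0)
      fix \<epsilon> assume \<epsilon>: "0 < \<epsilon> \<and> \<epsilon> \<le> \<epsilon>0"
      then have \<epsilon>pos: "\<epsilon> > 0" by simp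
      obtain X where X: "finite X" "X \<subseteq> F"
        "\<And>x. x \<in> F \<Longrightarrow> \<exists>y\<in>X. (THE \<nu>. unit_normal K y \<nu>) \<bullet> (y - x) \<le> \<epsilon> / 2 \<and>
          (THE \<nu>. unit_normal K y \<nu>) \<bullet> (THE \<nu>. unit_normal K x \<nu>) \<ge> 1 / 2"
        and Xc: "(real (card X))\<^sup>2 * (h * R * (4 * (\<epsilon> * R / 18) / (5 * real ?d)) ^ (?d - 1))
        \<le> ?g (2 * h) * ((4 * R) ^ ?d * B)"
        using net[of \<epsilon>] \<epsilon> by blast
      have "interior K \<noteq> {}" using K by (simp add: convex_body_def)
      then obtain P where P: "polytope P" "K \<subseteq> P" "hausdorff_dist K P \<le> \<epsilon>" "card {C. C facet_of P} \<le> card X"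
        using tangent_polytope[OF X(1,2) \<epsilon>pos _ X(3)] by blast
      note Xc
      also have "?g (2 * h) * ((4 * R) ^ ?d * B) \<le> (4 * h * S) * ((4 * R) ^ ?d * B)"
        using gh R B by (intro mult_right_mono) auto
      finally have "(real (card X))\<^sup>2 \<le> M * S / \<epsilon> ^ (?d - 1)"
        unfolding M_def by (rule facet_count_algebra[OF h R(1) \<epsilon>pos DIM_positive])
      also have "\<dots> = M * S / \<epsilon> powr q" using \<epsilon>pos unfolding q(2) by (simp only: powr_realpow)
      also have "\<dots> = ((c * surface_diameter K / \<epsilon>) powr (q / 2))\<^sup>2"
      proof -
        have "c * surface_diameter K = (M * s) powr (1 / q) * (S / s) powr (1 / q)"
          by (simp add: c_def surface_diameter_def S_def s_def q_def)
        also have "\<dots> = (M * S) powr (1 / q)"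
          using M s S by (subst powr_mult[symmetric]) auto
        finally have cs: "c * surface_diameter K = (M * S) powr (1 / q)" .
        have "((c * surface_diameter K / \<epsilon>) powr (q / 2))\<^sup>2 = (c * surface_diameter K / \<epsilon>) powr q"
          by (simp add: power2_eq_square flip: powr_add)
        also have "\<dots> = ((M * S) powr (1 / q)) powr q / \<epsilon> powr q"
          unfolding cs by (rule powr_divide)
        also have "\<dots> = M * S / \<epsilon> powr q"
          using q(1) M S by (simp add: powr_powr)
        finally show ?thesis by simp
      qed
      finally have "real (card X) \<le> (c * surface_diameter K / \<epsilon>) powr (q / 2)"
        by (rule power2_le_imp_le) simp
      then show "\<exists>P. polytope P \<and> K \<subseteq> P \<and> hausdorff_dist K P \<le> \<epsilon> \<and>
                   real (card {F. F facet_of P}) \<le> (c * surface_diameter K / \<epsilon>) powr ((real ?d - 1) / 2)"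
        using P unfolding q_def by (intro exI[of _ P]) force
    qed
  qed
qed

end
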